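(* Let $\|\cdot\|_\phi$ be a unitarily invariant norm on $M_n(\mathbb{C})$. Let $U,V\in\mathcal{U}(n)$ with $V=Ue^{iZ}$, where $Z$ is a Hermitian $n\times n$ matrix with $\|Z\|\le\pi$. Then the curve $\delta:[0,1]\to\mathcal{U}(n)$, $\delta(t)=Ue^{itZ}$, is at most as long as any other piecewise smooth curve $\gamma$ in $\mathcal{U}(n)$ joining $U$ to $V$, i.e. $L_\phi(\delta)\le L_\phi(\gamma)$. In particular, $d_\phi(U,V)=\|Z\|_\phi$. If moreover $\|U-V\|<2$ (equivalently, $\|Z\|<\pi$) and the norm $\|\cdot\|_\phi$ is strictly convex, then $\delta$ is, up to reparametrization, the unique shortest piecewise smooth path joining $U$ to $V$ in $\mathcal{U}(n)$.
   Context: $M_n(\mathbb{C})$ is the algebra of complex $n\times n$ matrices, $\mathcal{U}(n)$ the group of unitary matrices, $\|\cdot\|$ the spectral (operator) norm. A norm $\|\cdot\|_\phi$ on $M_n(\mathbb{C})$ is unitarily invariant if $\|UTV\|_\phi=\|T\|_\phi$ for all $T\in M_n(\mathbb{C})$, $U,V\in\mathcal{U}(n)$. For a piecewise smooth (continuous and piecewise $C^1$) curve $\gamma:[a,b]\to\mathcal{U}(n)$, $L_\phi(\gamma)=\int_a^b\|\dot\gamma(t)\|_\phi\,dt$, and $d_\phi(U,V)$ is the infimum of $L_\phi(\gamma)$ over all piecewise smooth curves $\gamma$ in $\mathcal{U}(n)$ joining $U$ to $V$. The norm is strictly convex if $\|A+B\|_\phi=\|A\|_\phi+\|B\|_\phi$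 implies $A=sB$ or $B=sA$ for some real $s\ge0$. A reparametrization of $\delta$ is a curve $\delta\circ\tau$ with $\tau:[a,b]\to[0,1]$ continuous, nondecreasing and surjective. *)

theory Defs
  imports "HOL-Analysis.Analysis"
begin

section \<open>Complex matrices\<close>

type_synonym 'n cmatrix = "complex^'n^'n"

definition cscale :: "complex \<Rightarrow> 'n cmatrix \<Rightarrow> ('n::finite) cmatrix" where
  "cscale c A = (\<chi> i j. c * A $ i $ j)"

definition conj_transpose :: "'n cmatrix \<Rightarrow> ('n::finite) cmatrix" where
  "conj_transpose A = (\<chi> i j. cnj (A $ j $ i))"

definition hermitian :: "('n::finite) cmatrix \<Rightarrow> bool" where
  "hermitian A \<longleftrightarrow> conj_transpose A = A"

definition unitary_group :: "('n::finite) cmatrix set" where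
  "unitary_group = {U. conj_transpose U ** U = mat 1 \<and> U ** conj_transpose U = mat 1}"

(* The norm of the type complex^'n^'n is the Frobenius norm; the norm of complex^'n is the
   Euclidean one, so onorm of the associated map is the spectral norm. *)
definition spectral_norm :: "('n::finite) cmatrix \<Rightarrow> real" where
  "spectral_norm A = onorm (\<lambda>x. A *v x)"

(* The ring multiplication and the unit 1 of the type complex^'n^'n are entrywise, so neither the power nor
   exp of the library is the matrix operation. *)
definition matrix_power :: "'n cmatrix \<Rightarrow> nat \<Rightarrow> ('n::finite) cmatrix" where
  "matrix_power A k = ((\<lambda>B. A ** B) ^^ k) (mat 1)"

definition matrix_exp :: "'n cmatrix \<Rightarrow> ('n::finite) cmatrix" where
  "matrix_exp A = (\<Sum>k. (1 / fact k) *\<^sub>R matrix_power A k)"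


section \<open>Norms on the space of matrices\<close>

definition is_norm :: "(('n::finite) cmatrix \<Rightarrow> real) \<Rightarrow> bool" where
  "is_norm \<phi> \<longleftrightarrow>
     (\<forall>A. \<phi> A \<ge> 0) \<and>
     (\<forall>A. \<phi> A = 0 \<longleftrightarrow> A = 0) \<and>
     (\<forall>c A. \<phi> (cscale c A) = cmod c * \<phi> A) \<and>
     (\<forall>A B. \<phi> (A + B) \<le> \<phi> A + \<phi> B)"

definition unitarily_invariant :: "(('n::finite) cmatrix \<Rightarrow> real) \<Rightarrow> bool" where
  "unitarily_invariant \<phi> \<longleftrightarrow>
     (\<forall>T. \<forall>U\<in>unitary_group. \<forall>V\<in>unitary_group. \<phi> (U ** T ** V) = \<phi> T)"

definition strictly_convex_norm :: "(('n::finite) cmatrix \<Rightarrow> real) \<Rightarrow> bool" where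
  "strictly_convex_norm \<phi> \<longleftrightarrow>
     (\<forall>A B. \<phi> (A + B) = \<phi> A + \<phi> B \<longrightarrow>
        (\<exists>s\<ge>0. A = s *\<^sub>R B \<or> B = s *\<^sub>R A))"


section \<open>Curves\<close>

(* One-sided derivatives at the endpoints. *)
definition C1_on_interval ::
  "(real \<Rightarrow> 'a::real_normed_vector) \<Rightarrow> real \<Rightarrow> real \<Rightarrow> bool" where
  "C1_on_interval \<gamma> a b \<longleftrightarrow>
     (\<exists>\<gamma>'. continuous_on {a..b} \<gamma>' \<and>
           (\<forall>t\<in>{a..b}. (\<gamma> has_vector_derivative \<gamma>' t) (at t within {a..b})))"

(* piecewise_C1_differentiable_on of the library is weaker: it only asks for C1 off a finite set, so
   the speed may blow up at a breakpoint, to the point of not being integrable. Here every piece is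
   C1 on its closed interval. *)
definition piecewise_smooth_curve ::
  "(real \<Rightarrow> 'a::real_normed_vector) \<Rightarrow> real \<Rightarrow> real \<Rightarrow> bool" where
  "piecewise_smooth_curve \<gamma> a b \<longleftrightarrow>
     a < b \<and> continuous_on {a..b} \<gamma> \<and>
     (\<exists>(m::nat) p. p 0 = a \<and> p m = b \<and>
        (\<forall>i<m. p i < p (Suc i) \<and> C1_on_interval \<gamma> (p i) (p (Suc i))))"

definition joining_curve ::
  "'n cmatrix \<Rightarrow> 'n cmatrix \<Rightarrow> (real \<Rightarrow> ('n::finite) cmatrix) \<Rightarrow> real \<Rightarrow> real \<Rightarrow> bool" where
  "joining_curve U V \<gamma> a b \<longleftrightarrow>
     piecewise_smooth_curve \<gamma> a b \<and> \<gamma> ` {a..b} \<subseteq> unitary_group \<and> \<gamma> a = U \<and> \<gamma> b = V"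

(* The derivative is unspecified at the finitely many breakpoints, which do not affect the
   integral. *)
definition curve_length ::
  "('n cmatrix \<Rightarrow> real) \<Rightarrow> (real \<Rightarrow> ('n::finite) cmatrix) \<Rightarrow> real \<Rightarrow> real \<Rightarrow> real" where
  "curve_length \<phi> \<gamma> a b =
     integral {a..b} (\<lambda>t. \<phi> (vector_derivative \<gamma> (at t within {a..b})))"

definition geodesic_dist ::
  "('n cmatrix \<Rightarrow> real) \<Rightarrow> 'n cmatrix \<Rightarrow> ('n::finite) cmatrix \<Rightarrow> real" where
  "geodesic_dist \<phi> U V = Inf {curve_length \<phi> \<gamma> a b | \<gamma> a b. joining_curve U V \<gamma> a b}"

definition shortest_curve ::
  "('n cmatrix \<Rightarrow> real) \<Rightarrow> 'n cmatrix \<Rightarrow> 'n cmatrix \<Rightarrow>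
   (real \<Rightarrow> ('n::finite) cmatrix) \<Rightarrow> real \<Rightarrow> real \<Rightarrow> bool" where
  "shortest_curve \<phi> U V \<gamma> a b \<longleftrightarrow>
     joining_curve U V \<gamma> a b \<and>
     (\<forall>\<eta> c d. joining_curve U V \<eta> c d \<longrightarrow> curve_length \<phi> \<gamma> a b \<le> curve_length \<phi> \<eta> c d)"

(* The curve \<gamma> on {a..b} is a reparametrization of the curve \<delta> on {0..1}. *)
definition reparametrization ::
  "(real \<Rightarrow> 'a) \<Rightarrow> real \<Rightarrow> real \<Rightarrow> (real \<Rightarrow> 'a) \<Rightarrow> bool" where
  "reparametrization \<gamma> a b \<delta> \<longleftrightarrow>
     (\<exists>\<tau>. continuous_on {a..b} \<tau> \<and> mono_on {a..b} \<tau> \<and> \<tau> ` {a..b} = {0..1} \<and>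
          (\<forall>t\<in>{a..b}. \<gamma> t = \<delta> (\<tau> t)))"

end

theory Submission
  imports Defs
begin

text \<open>
  Along a curve \<open>\<gamma>\<close> with \<open>\<gamma>' = i \<gamma> H\<close>, a logarithm of the curve is carried along: to first order,
  \<open>exp (i Z) exp (i h H)\<close> is conjugate to \<open>exp (i (Z + h P))\<close>, where \<open>Z\<close> is principal and \<open>P\<close> is the
  block diagonal part of \<open>H\<close> with respect to the eigenspaces of \<open>exp (i Z)\<close>. Since \<open>\<phi> P \<le> \<phi> H\<close>, a
  continuity argument gives a logarithm of the end point whose norm is at most the length of the
  curve, and a logarithm with spectrum in \<open>[-\<pi>, \<pi>]\<close> has minimal norm because \<open>\<phi>\<close> is monotone in the
  moduli of the eigenvalues. For uniqueness, a point of a shortest curve splits it as \<open>exp (i X)\<close>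
  followed by \<open>exp (i Y)\<close> with \<open>\<phi> X + \<phi> Y = \<phi> Z\<close>; cutting the corner yields
  \<open>\<phi> (X + P) = \<phi> X + \<phi> Y\<close>, and strict convexity forces \<open>P = Y\<close> and \<open>X\<close>, \<open>Y\<close> to be parallel.
\<close>

section \<open>Matrix algebra\<close>

text \<open>Eigenvalues of \<gamma> may collide or pass through -1, so no differentiable choice of a
  logarithm is attempted. At each time only the existence of a logarithm with a norm bound is
  claimed, first with errors growing linearly in time; compactness of the pairs (eigenbasis, bounded
  angles) then removes the errors. The part of \<open>H\<close> off the eigenspaces of exp (i Z) is
  a commutator term: to first order it is absorbed by conjugation with exp (i h K), which \<phi>
  does not see. Both inequalities for \<phi> come from midpoints of unitary orbits: a point of the
  unit disc is the mean of two points of the circle, and a block diagonal part is reached by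
  averaging with reflections. Strict convexity therefore settles both equality cases. Cutting the
  corner over a fraction h of the second arc gains at least h (\<phi> X + \<phi> Y - \<phi> (X + P))
  up to o(h), for a suitable logarithm \<open>X\<close> of the corner point; a shortest path admits
  no gain. Applied at every time, this puts the point of the curve on \<delta> at the fraction of
  arc length used so far, so the reparametrization is continuous and monotone by
  construction.\<close>

abbreviation adj :: "'n cmatrix \<Rightarrow> ('n::finite) cmatrix" where
  "adj \<equiv> conj_transpose"

definition diag_mat :: "('n \<Rightarrow> complex) \<Rightarrow> ('n::finite) cmatrix" where
  "diag_mat d = (\<chi> i j. if i = j then d i else 0)"

lemma adj_mult: "adj (A ** B) = adj B ** adj A"
  by (simp add: conj_transpose_def matrix_matrix_mult_def vec_eq_iff mult.commute)

lemma adj_adj [simp]: "adj (adj A) = A"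
  by (simp add: conj_transpose_def vec_eq_iff)

lemma adj_add: "adj (A + B) = adj A + adj B"
  by (simp add: conj_transpose_def vec_eq_iff)

lemma adj_cscale: "adj (cscale c A) = cscale (cnj c) (adj A)"
  by (simp add: conj_transpose_def cscale_def vec_eq_iff)

lemma adj_scaleR: "adj (r *\<^sub>R A) = r *\<^sub>R adj A"
  by (simp add: conj_transpose_def vec_eq_iff)

lemma adj_diag: "adj (diag_mat d) = diag_mat (\<lambda>j. cnj (d j))"
  by (auto simp: conj_transpose_def diag_mat_def vec_eq_iff)

lemma diag_one: "diag_mat (\<lambda>j. 1) = mat 1"
  by (simp add: diag_mat_def mat_def)

lemma adj_mat_1 [simp]: "adj (mat 1) = mat 1"
  using adj_diag[of "\<lambda>j. 1"] by (simp add: diag_one)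

lemma cscale_mult_left: "cscale c A ** B = cscale c (A ** B)"
  by (simp add: cscale_def matrix_matrix_mult_def vec_eq_iff sum_distrib_left mult.assoc)

lemma cscale_mult_right: "A ** cscale c B = cscale c (A ** B)"
  by (simp add: cscale_def matrix_matrix_mult_def vec_eq_iff sum_distrib_left algebra_simps)

lemma cscale_cscale [simp]: "cscale c (cscale d A) = cscale (c * d) A"
  by (simp add: cscale_def vec_eq_iff)

lemma cscale_add: "cscale c (A + B) = cscale c A + cscale c B"
  by (simp add: cscale_def vec_eq_iff algebra_simps)

lemma cscale_diff: "cscale c (A - B) = cscale c A - cscale c B"
  by (simp add: cscale_def vec_eq_iff algebra_simps)

lemma cscale_of_real: "cscale (complex_of_real r) A = r *\<^sub>R A"
  by (simp add: cscale_def vec_eq_iff) (simp add: scaleR_conv_of_real)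

lemma cscale_one [simp]: "cscale 1 A = A"
  by (simp add: cscale_def vec_eq_iff)

lemma cscale_zero [simp]: "cscale c 0 = 0" "cscale 0 A = 0"
  by (simp_all add: cscale_def vec_eq_iff)

lemma cscale_minus_one: "cscale (-1) A = - A"
  by (simp add: cscale_def vec_eq_iff)

lemma cscale_scaleR: "cscale c (r *\<^sub>R A) = r *\<^sub>R cscale c A"
  by (simp add: cscale_of_real[symmetric] mult.commute)

lemma scaleR_mult_left: "(r *\<^sub>R A) ** B = r *\<^sub>R (A ** B)" for A B :: "('n::finite) cmatrix"
  by (simp add: cscale_of_real[symmetric] cscale_mult_left)

lemma scaleR_mult_right: "A ** (r *\<^sub>R B) = r *\<^sub>R (A ** B)" for A B :: "('n::finite) cmatrix"
  by (simp add: cscale_of_real[symmetric] cscale_mult_right)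

lemma matrix_diff_ldistrib: "A ** (B - C) = A ** B - A ** C" for A B C :: "('n::finite) cmatrix"
  by (simp add: matrix_matrix_mult_def vec_eq_iff sum_subtractf algebra_simps)

lemma matrix_diff_rdistrib: "(A - B) ** C = A ** C - B ** C" for A B C :: "('n::finite) cmatrix"
  by (simp add: matrix_matrix_mult_def vec_eq_iff sum_subtractf algebra_simps)

lemma matrix_add_rdistrib: "(A + B) ** C = A ** C + B ** C" for A B C :: "('n::finite) cmatrix"
  by (simp add: matrix_matrix_mult_def vec_eq_iff sum.distrib algebra_simps)

lemma norm_entry_le: "cmod (A $ i $ j) \<le> norm A" for A :: "('n::finite) cmatrix"
  by (rule order_trans[OF Finite_Cartesian_Product.norm_nth_le Finite_Cartesian_Product.norm_nth_le])

lemma norm_matrix_le_sum: "norm A \<le> (\<Sum>i\<in>UNIV. \<Sum>j\<in>UNIV. cmod (A $ i $ j))"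
  for A :: "('n::finite) cmatrix"
proof -
  have *: "norm v \<le> (\<Sum>j\<in>UNIV. norm (v $ j))" for v :: "'a::real_normed_vector^'n"
    by (simp add: norm_vec_def L2_set_le_sum)
  show ?thesis
    by (rule order_trans[OF *]) (intro sum_mono *)
qed

lemma bounded_bilinear_matrix_mult:
  "bounded_bilinear ((**) :: ('n::finite) cmatrix \<Rightarrow> 'n cmatrix \<Rightarrow> 'n cmatrix)"
  by (simp add: bilinear_conv_bounded_bilinear[symmetric] bilinear_def linear_iff
      matrix_add_ldistrib matrix_add_rdistrib scaleR_mult_left scaleR_mult_right)

lemmas has_vector_derivative_matrix_mult =
  bounded_bilinear.has_vector_derivative[OF bounded_bilinear_matrix_mult]
lemmas continuous_on_matrix_mult [continuous_intros] =
  bounded_bilinear.continuous_on[OF bounded_bilinear_matrix_mult]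

lemma continuous_on_entries:
  fixes f :: "'a::topological_space \<Rightarrow> ('n::finite) cmatrix"
  assumes "\<And>i j. continuous_on S (\<lambda>x. f x $ i $ j)"
  shows "continuous_on S f"
  using continuous_on_vec_lambda[of S "\<lambda>i x. f x $ i"]
    continuous_on_vec_lambda[of S "\<lambda>j x. f x $ _ $ j"] assms by simp

lemma bounded_linear_adj: "bounded_linear (adj :: ('n::finite) cmatrix \<Rightarrow> _)"
  by (simp add: linear_conv_bounded_linear[symmetric] linear_iff adj_add adj_scaleR)

lemmas continuous_on_adj [continuous_intros] =
  bounded_linear.continuous_on[OF bounded_linear_adj]

lemma bounded_linear_cscale: "bounded_linear (cscale c :: ('n::finite) cmatrix \<Rightarrow> _)"
  by (simp add: linear_conv_bounded_linear[symmetric] linear_iff cscale_add cscale_scaleR)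

lemma bounded_linear_cscale_left: "bounded_linear (\<lambda>c. cscale c A :: ('n::finite) cmatrix)"
  by (simp add: linear_conv_bounded_linear[symmetric] linear_iff vec_eq_iff cscale_def algebra_simps)

lemmas continuous_on_cscale [continuous_intros] =
  bounded_linear.continuous_on[OF bounded_linear_cscale]

lemma diag_entry: "diag_mat d $ i $ j = (if i = j then d i else 0)"
  by (simp add: diag_mat_def)

lemma diag_mult_left: "(diag_mat d ** A) $ i $ j = d i * A $ i $ j"
  by (simp add: matrix_matrix_mult_def diag_entry if_distrib[where f="\<lambda>x. x * _"] cong: if_cong)

lemma diag_mult_right: "(A ** diag_mat d) $ i $ j = A $ i $ j * d j"
  by (simp add: matrix_matrix_mult_def diag_entry if_distrib[where f="\<lambda>x. _ * x"] cong: if_cong)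

lemma diag_mult: "diag_mat c ** diag_mat d = diag_mat (\<lambda>j. c j * d j)"
  by (simp add: vec_eq_iff diag_mult_left diag_entry)

lemma diag_add: "diag_mat c + diag_mat d = diag_mat (\<lambda>j. c j + d j)"
  by (simp add: vec_eq_iff diag_entry)

lemma diag_cscale: "cscale c (diag_mat d) = diag_mat (\<lambda>j. c * d j)"
  by (simp add: vec_eq_iff diag_entry cscale_def)

lemma diag_inj: "diag_mat c = diag_mat d \<Longrightarrow> c j = d j"
  by (metis diag_entry)

section \<open>Unitary matrices\<close>

lemma unitaryD: "U \<in> unitary_group \<Longrightarrow> adj U ** U = mat 1"
    "U \<in> unitary_group \<Longrightarrow> U ** adj U = mat 1"
  by (auto simp: unitary_group_def)

lemma unitary_cancel: "U \<in> unitary_group \<Longrightarrow> adj U ** (U ** A) = A"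
    "U \<in> unitary_group \<Longrightarrow> U ** (adj U ** A) = A"
  by (simp_all add: matrix_mul_assoc unitaryD)

lemma unitaryI: "adj U ** U = mat 1 \<Longrightarrow> U \<in> unitary_group"
  by (simp add: unitary_group_def matrix_left_right_inverse)

lemma unitary_adj: "U \<in> unitary_group \<Longrightarrow> adj U \<in> unitary_group"
  by (simp add: unitary_group_def)

lemma unitary_one: "mat 1 \<in> unitary_group"
  by (simp add: unitary_group_def)

lemma unitary_mult: "U \<in> unitary_group \<Longrightarrow> V \<in> unitary_group \<Longrightarrow> U ** V \<in> unitary_group"
  by (rule unitaryI) (simp add: adj_mult matrix_mul_assoc[symmetric] unitary_cancel unitaryD)

lemma unitary_diag: "(\<And>j. cmod (d j) = 1) \<Longrightarrow> diag_mat d \<in> unitary_group"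
  by (rule unitaryI) (simp add: adj_diag diag_mult diag_one[symmetric] complex_norm_square[symmetric]
      mult.commute[of "cnj _"])

text \<open>The columns are unit vectors, which bounds every entry by 1. This compactness later
  turns approximate logarithms into exact ones.\<close>

lemma compact_unitary: "compact (unitary_group :: ('n::finite) cmatrix set)"
proof (unfold compact_eq_bounded_closed, rule conjI)
  have "norm U \<le> CARD('n) * CARD('n)" if "U \<in> unitary_group" for U :: "'n cmatrix"
  proof -
    have "cmod (U $ k $ i) \<le> 1" for k i
    proof -
      have "(adj U ** U) $ i $ i = 1"
        using that by (simp add: unitaryD mat_def)
      then have "(\<Sum>k\<in>UNIV. complex_of_real ((cmod (U $ k $ i))\<^sup>2)) = 1"
        by (simp add: matrix_matrix_mult_def conj_transpose_def complex_norm_square mult.commute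
            del: of_real_power)
      then have "complex_of_real (\<Sum>k\<in>UNIV. (cmod (U $ k $ i))\<^sup>2) = complex_of_real 1"
        by (simp del: of_real_power)
      then have "(\<Sum>k\<in>UNIV. (cmod (U $ k $ i))\<^sup>2) = 1"
        by (simp only: of_real_eq_iff)
      moreover have "(cmod (U $ k $ i))\<^sup>2 \<le> (\<Sum>k\<in>UNIV. (cmod (U $ k $ i))\<^sup>2)"
        by (rule member_le_sum) auto
      ultimately have "(cmod (U $ k $ i))\<^sup>2 \<le> 1\<^sup>2" by simp
      then show ?thesis by (rule power2_le_imp_le) simp
    qed
    then have "(\<Sum>i\<in>(UNIV::'n set). \<Sum>j\<in>(UNIV::'n set). cmod (U $ i $ j)) \<le> (\<Sum>i\<in>(UNIV::'n set). \<Sum>j\<in>(UNIV::'n set). 1)"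
      by (intro sum_mono)
    with norm_matrix_le_sum[of U] show ?thesis by simp
  qed
  then show "bounded (unitary_group :: 'n cmatrix set)"
    by (auto simp: bounded_iff)
  show "closed (unitary_group :: 'n cmatrix set)"
    unfolding unitary_group_def
    by (intro closed_Collect_conj closed_Collect_eq continuous_intros)
qed

section \<open>Functional calculus in a fixed eigenbasis\<close>

definition udiag :: "'n cmatrix \<Rightarrow> ('n \<Rightarrow> complex) \<Rightarrow> ('n::finite) cmatrix" where
  "udiag Q d = Q ** diag_mat d ** adj Q"

lemma udiag_mult: "Q \<in> unitary_group \<Longrightarrow> udiag Q c ** udiag Q d = udiag Q (\<lambda>j. c j * d j)"
  by (simp add: udiag_def matrix_mul_assoc[symmetric] unitary_cancel diag_mult[symmetric])

lemma udiag_one: "Q \<in> unitary_group \<Longrightarrow> udiag Q (\<lambda>j. 1) = mat 1"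
  by (simp add: udiag_def diag_one unitaryD)

lemma adj_udiag: "adj (udiag Q d) = udiag Q (\<lambda>j. cnj (d j))"
  by (simp add: udiag_def adj_mult adj_diag matrix_mul_assoc)

lemma udiag_cscale: "cscale c (udiag Q d) = udiag Q (\<lambda>j. c * d j)"
  by (simp add: udiag_def diag_cscale[symmetric] cscale_mult_left cscale_mult_right)

lemma udiag_add: "udiag Q c + udiag Q d = udiag Q (\<lambda>j. c j + d j)"
  by (simp add: udiag_def diag_add[symmetric] matrix_add_ldistrib matrix_add_rdistrib)

lemma unitary_udiag: "Q \<in> unitary_group \<Longrightarrow> (\<And>j. cmod (d j) = 1) \<Longrightarrow> udiag Q d \<in> unitary_group"
  by (simp add: udiag_def unitary_mult unitary_adj unitary_diag)

lemma hermitian_udiag: "hermitian (udiag Q (\<lambda>j. complex_of_real (\<theta> j)))"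
  by (simp add: hermitian_def adj_udiag)

lemma continuous_on_udiag:
  assumes "continuous_on S Q" and "\<And>j. continuous_on S (\<lambda>x. d x j)"
  shows "continuous_on S (\<lambda>x. udiag (Q x) (d x))"
proof -
  have "continuous_on S (\<lambda>x. diag_mat (d x))"
  proof (rule continuous_on_entries)
    fix i j show "continuous_on S (\<lambda>x. diag_mat (d x) $ i $ j)"
      using assms(2) by (cases "i = j") (simp_all add: diag_entry)
  qed
  then show ?thesis
    unfolding udiag_def by (intro continuous_intros assms)
qed

text \<open>The intertwiner of two diagonal matrices only has entries between equal eigenvalues, so it
  also intertwines all functions of them.\<close>

lemma intertwine_diag:
  assumes "diag_mat c ** S = S ** diag_mat d" and "\<And>j k. c j = d k \<Longrightarrow> c' j = d' k"
  shows "diag_mat c' ** S = S ** diag_mat d'"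
proof -
  have "c' i * S $ i $ j = S $ i $ j * d' j" for i j
  proof -
    have "c i * S $ i $ j = S $ i $ j * d j"
      using assms(1) by (metis diag_mult_left diag_mult_right)
    then show ?thesis using assms(2)[of i j] by (cases "S $ i $ j = 0") auto
  qed
  then show ?thesis by (simp add: vec_eq_iff diag_mult_left diag_mult_right)
qed

text \<open>In the two eigenbases \<open>S\<close> becomes \<open>adj Q1 ** S ** Q2\<close>, which
  reduces the claim to diagonal matrices. With \<open>S\<close> the identity this compares two
  diagonalizations; with one basis and one spectrum it says that whatever commutes with a matrix
  commutes with its functions.\<close>

lemma intertwine_udiag:
  assumes "Q1 \<in> unitary_group" "Q2 \<in> unitary_group"
    and "udiag Q1 c ** S = S ** udiag Q2 d" and "\<And>j k. c j = d k \<Longrightarrow> c' j = d' k"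
  shows "udiag Q1 c' ** S = S ** udiag Q2 d'"
proof -
  have "diag_mat c ** (adj Q1 ** S ** Q2) = adj Q1 ** (udiag Q1 c ** S) ** Q2"
    using assms(1) by (simp add: udiag_def matrix_mul_assoc[symmetric] unitary_cancel)
  also have "\<dots> = (adj Q1 ** S ** Q2) ** diag_mat d"
    using assms(2) by (simp add: assms(3)) (simp add: udiag_def matrix_mul_assoc[symmetric] unitaryD)
  finally have *: "diag_mat c' ** (adj Q1 ** S ** Q2) = (adj Q1 ** S ** Q2) ** diag_mat d'"
    by (rule intertwine_diag) (rule assms(4))
  have "udiag Q1 c' ** S = Q1 ** (diag_mat c' ** (adj Q1 ** S ** Q2)) ** adj Q2"
    using assms(2) by (simp add: udiag_def matrix_mul_assoc[symmetric] unitaryD)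
  also have "\<dots> = S ** udiag Q2 d'"
    using assms(1) by (simp add: * ) (simp add: udiag_def matrix_mul_assoc[symmetric] unitary_cancel)
  finally show ?thesis .
qed

section \<open>The spectral theorem\<close>

text \<open>Conjugate linear in the first argument, so that its real part is the real inner product
  of the type; Euclidean facts about orthogonality and dimension apply through it.\<close>

definition cinner :: "complex^'n \<Rightarrow> complex^('n::finite) \<Rightarrow> complex" where
  "cinner x y = (\<Sum>i\<in>UNIV. cnj (x $ i) * y $ i)"

lemma Re_cinner: "Re (cinner x y) = x \<bullet> y"
  by (simp add: cinner_def inner_vec_def inner_complex_def)

lemma Im_cinner: "Im (cinner x y) = (\<i> *s x) \<bullet> y"
  by (simp add: cinner_def inner_vec_def inner_complex_def)

lemma cinner_self: "cinner x x = complex_of_real ((norm x)\<^sup>2)"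
proof -
  have "Im (cinner x x) = 0"
    by (simp add: cinner_def mult.commute)
  then show ?thesis
    by (simp add: complex_eq_iff Re_cinner power2_norm_eq_inner)
qed

lemma cinner_commute: "cinner y x = cnj (cinner x y)"
  by (simp add: cinner_def mult.commute)

lemma cinner_adj: "cinner x (A *v y) = cinner (adj A *v x) y"
proof -
  have "cinner x (A *v y) = (\<Sum>i\<in>UNIV. \<Sum>j\<in>UNIV. cnj (x $ i) * A $ i $ j * y $ j)"
    by (simp add: cinner_def matrix_vector_mult_def sum_distrib_left mult.assoc)
  also have "\<dots> = (\<Sum>j\<in>UNIV. \<Sum>i\<in>UNIV. cnj (x $ i) * A $ i $ j * y $ j)"
    by (rule sum.swap)
  also have "\<dots> = cinner (adj A *v x) y"
    by (simp add: cinner_def matrix_vector_mult_def conj_transpose_def sum_distrib_right)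
      (simp add: mult_ac)
  finally show ?thesis .
qed

lemma cinner_hermitian: "hermitian Z \<Longrightarrow> cinner x (Z *v y) = cinner (Z *v x) y"
  by (simp add: cinner_adj hermitian_def)

lemma cinner_add_right: "cinner x (y + z) = cinner x y + cinner x z"
  by (simp add: cinner_def algebra_simps sum.distrib)

lemma cinner_scaleR_right: "cinner x (r *\<^sub>R y) = complex_of_real r * cinner x y"
  by (simp add: cinner_def sum_distrib_left) (simp add: scaleR_conv_of_real[where 'a=complex] algebra_simps)

text \<open>The first order condition at a maximum: for small \<open>t\<close> the linear term
  decides the sign.\<close>

lemma quadratic_nonpos_imp:
  fixes b c :: real
  assumes "\<And>t. 2 * t * b + t\<^sup>2 * c \<le> 0"
  shows "b = 0"
proof (rule ccontr)
  assume "b \<noteq> 0"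
  \<comment> \<open>For this \<open>t\<close> the quadratic term is at most \<open>t * b\<close> in
    modulus, half of the linear term.\<close>
  define t where "t = b / (1 + \<bar>c\<bar>)"
  have "t * b = b\<^sup>2 / (1 + \<bar>c\<bar>)" by (simp add: t_def power2_eq_square)
  moreover have "t\<^sup>2 * c \<ge> - (b\<^sup>2 / (1 + \<bar>c\<bar>))"
  proof -
    have "t\<^sup>2 * - c \<le> t\<^sup>2 * (1 + \<bar>c\<bar>)" by (intro mult_left_mono) auto
    also have "\<dots> = b\<^sup>2 / (1 + \<bar>c\<bar>)" by (simp add: t_def power2_eq_square)
    finally show ?thesis by simp
  qed
  moreover have "b\<^sup>2 / (1 + \<bar>c\<bar>) > 0" using \<open>b \<noteq> 0\<close> by simp
  ultimately show False using assms[of t] by simp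
qed

text \<open>A maximizer of the Rayleigh quotient on an invariant subspace is an eigenvector.\<close>

lemma hermitian_eigenvector:
  fixes Z :: "('n::finite) cmatrix"
  assumes Z: "hermitian Z" and M: "subspace M" "\<And>y. y \<in> M \<Longrightarrow> Z *v y \<in> M"
    and "w \<in> M" "w \<noteq> 0"
  shows "\<exists>x\<in>M. \<exists>m. norm x = 1 \<and> Z *v x = complex_of_real m *s x"
proof -
  let ?S = "M \<inter> sphere 0 1"
  have lin: "linear ((*v) Z)"
    by (simp add: linear_iff matrix_vector_right_distrib)
      (simp add: matrix_vector_mult_def vec_eq_iff scaleR_sum_right)
  have self: "x \<bullet> (Z *v y) = (Z *v x) \<bullet> y" for x y
    by (simp add: Re_cinner[symmetric] cinner_hermitian[OF Z])
  have sR: "a *\<^sub>R v = complex_of_real a *s v" for a and v :: "complex^'n"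
    by (simp add: vec_eq_iff scaleR_conv_of_real[where 'a=complex])
  have "compact ?S"
    by (intro closed_Int_compact closed_subspace M compact_sphere)
  moreover have "(1 / norm w) *\<^sub>R w \<in> ?S"
    using assms by (auto intro: subspace_scale)
  moreover have "continuous_on ?S (\<lambda>y. y \<bullet> (Z *v y))"
    by (intro continuous_intros linear_continuous_on linear_linear[THEN iffD2] lin)
  ultimately obtain x where x: "x \<in> ?S" and max: "\<And>y. y \<in> ?S \<Longrightarrow> y \<bullet> (Z *v y) \<le> x \<bullet> (Z *v x)"
    using continuous_attains_sup[of ?S "\<lambda>y. y \<bullet> (Z *v y)"] by blast
  define m where "m = x \<bullet> (Z *v x)"
  have hom: "y \<bullet> (Z *v y) \<le> m * (y \<bullet> y)" if "y \<in> M" for y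
  proof (cases "y = 0")
    case False
    then have "(1 / norm y) *\<^sub>R y \<in> ?S" using that M by (auto intro: subspace_scale)
    then have "((1 / norm y) *\<^sub>R y) \<bullet> (Z *v ((1 / norm y) *\<^sub>R y)) \<le> m"
      unfolding m_def by (rule max)
    then have "(y \<bullet> (Z *v y)) / (norm y)\<^sup>2 \<le> m"
      by (simp add: linear_scale[OF lin] power2_eq_square)
    then show ?thesis using False by (simp add: field_simps power2_norm_eq_inner)
  qed simp
  \<comment> \<open>The form \<open>m * (y \<bullet> y) - y \<bullet> (Z *v y)\<close> is
    nonnegative on \<open>M\<close> and vanishes at \<open>x\<close>, so its first variation at
    \<open>x\<close> is zero in every direction of \<open>M\<close>.\<close>
  have orth: "y \<bullet> (Z *v x - m *\<^sub>R x) = 0" if "y \<in> M" for y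
  proof (rule quadratic_nonpos_imp)
    fix t :: real
    have "x + t *\<^sub>R y \<in> M" using that x M by (auto intro: subspace_add subspace_scale)
    from hom[OF this] have "x \<bullet> (Z *v x) + t * (x \<bullet> (Z *v y)) + t * (y \<bullet> (Z *v x)) + t\<^sup>2 * (y \<bullet> (Z *v y))
        \<le> m * (x \<bullet> x + 2 * t * (x \<bullet> y) + t\<^sup>2 * (y \<bullet> y))"
      by (simp add: linear_scale[OF lin] linear_add[OF lin] algebra_simps inner_commute power2_eq_square)
    moreover have "x \<bullet> (Z *v y) = y \<bullet> (Z *v x)" using self[of x y] by (simp add: inner_commute)
    moreover have "x \<bullet> x = 1" using x by (simp add: power2_norm_eq_inner[symmetric])
    ultimately show "2 * t * (y \<bullet> (Z *v x - m *\<^sub>R x)) + t\<^sup>2 * (y \<bullet> (Z *v y) - m * (y \<bullet> y)) \<le> 0"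
      by (simp add: m_def[symmetric] algebra_simps inner_commute)
  qed
  have "Z *v x - m *\<^sub>R x \<in> M"
    using x M by (auto intro: subspace_diff subspace_scale)
  \<comment> \<open>The residual lies in \<open>M\<close> itself, hence is orthogonal to
    itself.\<close>
  from orth[OF this] have "Z *v x = m *\<^sub>R x" by simp
  then show ?thesis using x by (auto simp: sR)
qed

text \<open>Induction on the indices already served: the next eigenvector is sought in the complex
  orthogonal complement of the previous ones, which \<open>Z\<close> preserves because it is
  Hermitian.\<close>

lemma hermitian_eigenbasis:
  fixes Z :: "('n::finite) cmatrix"
  assumes Z: "hermitian Z"
  shows "\<exists>q \<theta>. \<forall>j\<in>(A::'n set). Z *v q j = complex_of_real (\<theta> j) *s q j \<and>
    (\<forall>k\<in>A. cinner (q j) (q k) = (if j = k then 1 else 0))"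
  (is "\<exists>q \<theta>. ?P A q \<theta>")
proof -
  have "finite A" by simp
  then show ?thesis
  proof (induction A rule: finite_induct)
    case empty
    show ?case by simp
  next
    case (insert a A)
    then obtain q \<theta> where q: "?P A q \<theta>" by blast
    \<comment> \<open>Real orthogonality to both \<open>q j\<close> and \<open>\<i> *s q j\<close>
      is complex orthogonality. The two families have fewer elements than the real dimension, which
      is twice the number of indices.\<close>
    let ?S = "q ` A \<union> (\<lambda>j. \<i> *s q j) ` A"
    have "card ?S \<le> card A + card A"
      by (rule order_trans[OF card_Un_le]) (intro add_mono card_image_le finite)
    also have "card A < CARD('n)"
      using insert.hyps by (intro psubset_card_mono) auto
    finally have "card ?S < DIM(complex^'n)" by (simp add: mult_2)
    then have "dim ?S < DIM(complex^'n)"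
      using dim_le_card'[of ?S] by simp
    then obtain w where w: "w \<noteq> 0" "\<And>y. y \<in> span ?S \<Longrightarrow> orthogonal w y"
      using orthogonal_to_subspace_exists by metis
    define M where "M = {y. \<forall>j\<in>A. cinner (q j) y = 0}"
    have "cinner (q j) w = 0" if "j \<in> A" for j
    proof -
      have "w \<bullet> q j = 0" "w \<bullet> (\<i> *s q j) = 0"
        using w(2)[of "q j"] w(2)[of "\<i> *s q j"] that by (auto simp: orthogonal_def span_base)
      then show ?thesis by (simp add: complex_eq_iff Re_cinner Im_cinner inner_commute)
    qed
    then have wM: "w \<in> M" by (simp add: M_def)
    have "subspace M"
      by (auto simp: M_def subspace_def cinner_add_right cinner_scaleR_right) (simp add: cinner_def)
    moreover have "Z *v y \<in> M" if "y \<in> M" for y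
    proof -
      have "cinner (q j) (Z *v y) = 0" if j: "j \<in> A" for j
      proof -
        have "cinner (q j) (Z *v y) = complex_of_real (\<theta> j) * cinner (q j) y"
          using q j by (simp add: cinner_hermitian[OF Z]) (simp add: cinner_def sum_distrib_left algebra_simps)
        then show ?thesis using \<open>y \<in> M\<close> j by (simp add: M_def)
      qed
      then show ?thesis by (simp add: M_def)
    qed
    ultimately obtain x m where x: "x \<in> M" "norm x = 1" "Z *v x = complex_of_real m *s x"
      using hermitian_eigenvector[OF Z _ _ wM w(1)] by blast
    have 1: "cinner (q j) x = 0" if "j \<in> A" for j using x(1) that by (simp add: M_def)
    then have "cinner x (q j) = 0" if "j \<in> A" for j using that by (simp add: cinner_commute[of x])
    moreover have "cinner x x = 1" by (simp add: cinner_self x)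
    ultimately have "?P (insert a A) (q(a := x)) (\<theta>(a := m))"
      using q 1 x insert.hyps by auto
    then show ?case by blast
  qed
qed

lemma hermitian_diagonalization:
  assumes "hermitian Z"
  obtains Q \<theta> where "Q \<in> unitary_group" "Z = udiag Q (\<lambda>j. complex_of_real (\<theta> j))"
proof -
  obtain q \<theta> where q: "\<And>j::'a. Z *v q j = complex_of_real (\<theta> j) *s q j"
    "\<And>j k::'a. cinner (q j) (q k) = (if j = k then 1 else 0)"
    using hermitian_eigenbasis[OF assms, of UNIV] by blast
  define Q where "Q = (\<chi> i j. q j $ i)"
  have Q: "Q \<in> unitary_group"
  proof (rule unitaryI)
    have "(adj Q ** Q) $ j $ k = cinner (q j) (q k)" for j k
      by (simp add: matrix_matrix_mult_def conj_transpose_def Q_def cinner_def)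
    then show "adj Q ** Q = mat 1"
      by (simp add: vec_eq_iff q mat_def)
  qed
  have "(Z ** Q) $ i $ j = (Q ** diag_mat (\<lambda>j. complex_of_real (\<theta> j))) $ i $ j" for i j
  proof -
    have "(Z ** Q) $ i $ j = (Z *v q j) $ i"
      by (simp add: matrix_matrix_mult_def matrix_vector_mult_def Q_def)
    also have "\<dots> = (Q ** diag_mat (\<lambda>j. complex_of_real (\<theta> j))) $ i $ j"
      by (simp add: q diag_mult_right) (simp add: Q_def)
    finally show ?thesis .
  qed
  then have "Z ** Q = Q ** diag_mat (\<lambda>j. complex_of_real (\<theta> j))"
    by (simp add: vec_eq_iff)
  then have "Z = udiag Q (\<lambda>j. complex_of_real (\<theta> j))"
    using Q by (metis matrix_mul_assoc matrix_mul_rid udiag_def unitaryD(2))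
  with Q show ?thesis by (rule that)
qed

section \<open>The exponential of a Hermitian matrix\<close>

definition hexp :: "real \<Rightarrow> 'n cmatrix \<Rightarrow> ('n::finite) cmatrix" where
  "hexp t Z = matrix_exp (cscale (\<i> * complex_of_real t) Z)"

lemma matrix_power_udiag:
  "Q \<in> unitary_group \<Longrightarrow> matrix_power (udiag Q d) k = udiag Q (\<lambda>j. d j ^ k)"
proof (induction k)
  case (Suc k)
  then have "udiag Q d ** matrix_power (udiag Q d) k = udiag Q (\<lambda>j. d j ^ Suc k)"
    by (simp add: udiag_mult)
  then show ?case by (simp add: matrix_power_def)
qed (simp add: matrix_power_def udiag_one)

text \<open>On the diagonal the series is the scalar one, and conjugation by \<open>Q\<close> is
  bounded linear, so it passes through the sum. Convergence, which the definition leaves open, is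
  part of the result.\<close>

lemma matrix_exp_udiag:
  assumes "Q \<in> unitary_group"
  shows "matrix_exp (udiag Q d) = udiag Q (\<lambda>j. exp (d j))"
proof -
  have "(\<lambda>k. diag_mat (\<lambda>j. d j ^ k /\<^sub>R fact k)) sums diag_mat (\<lambda>j. exp (d j))"
    unfolding sums_def
  proof (intro vec_tendstoI)
    fix i j
    have "(\<lambda>n. \<Sum>k<n. diag_mat (\<lambda>j. d j ^ k /\<^sub>R fact k) $ i $ j) \<longlonglongrightarrow> diag_mat (\<lambda>j. exp (d j)) $ i $ j"
      using exp_converges[of "d i"] by (cases "i = j") (simp_all add: diag_entry sums_def)
    then show "(\<lambda>n. (\<Sum>k<n. diag_mat (\<lambda>j. d j ^ k /\<^sub>R fact k)) $ i $ j) \<longlonglongrightarrow> diag_mat (\<lambda>j. exp (d j)) $ i $ j"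
      by simp
  qed
  moreover have "bounded_linear (\<lambda>A. Q ** A ** adj Q)"
    by (rule bounded_linear_compose[OF
          bounded_bilinear.bounded_linear_left[OF bounded_bilinear_matrix_mult]
          bounded_bilinear.bounded_linear_right[OF bounded_bilinear_matrix_mult]])
  ultimately have "(\<lambda>k. udiag Q (\<lambda>j. d j ^ k /\<^sub>R fact k)) sums udiag Q (\<lambda>j. exp (d j))"
    unfolding udiag_def by (rule bounded_linear.sums[rotated])
  moreover have "udiag Q (\<lambda>j. d j ^ k /\<^sub>R fact k) = (1 / fact k) *\<^sub>R matrix_power (udiag Q d) k" for k
    by (simp add: matrix_power_udiag[OF assms] cscale_of_real[symmetric] udiag_cscale)
      (simp add: scaleR_conv_of_real divide_inverse mult.commute)
  ultimately show ?thesis by (simp add: matrix_exp_def sums_unique[symmetric])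
qed

lemma hexp_udiag:
  assumes "Q \<in> unitary_group"
  shows "hexp t (udiag Q (\<lambda>j. complex_of_real (\<theta> j))) = udiag Q (\<lambda>j. cis (t * \<theta> j))"
  by (simp add: hexp_def udiag_cscale matrix_exp_udiag[OF assms] cis_conv_exp mult.assoc)

lemma hexp_scaleR: "hexp t (r *\<^sub>R Z) = hexp (t * r) Z"
  by (simp add: hexp_def cscale_of_real[symmetric] mult.assoc)

lemma hexp_minus: "hexp t (- Z) = hexp (- t) Z"
  using hexp_scaleR[of t "-1" Z] by simp

lemma hexp_zero: "hermitian Z \<Longrightarrow> hexp 0 Z = mat 1"
  by (erule hermitian_diagonalization) (simp add: hexp_udiag udiag_one)

lemma unitary_hexp: "hermitian Z \<Longrightarrow> hexp t Z \<in> unitary_group"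
  by (erule hermitian_diagonalization) (simp add: hexp_udiag unitary_udiag)

lemma hexp_add: "hermitian Z \<Longrightarrow> hexp (s + t) Z = hexp s Z ** hexp t Z"
  by (erule hermitian_diagonalization) (simp add: hexp_udiag udiag_mult cis_mult ring_distribs)

lemma adj_hexp: "hermitian Z \<Longrightarrow> adj (hexp t Z) = hexp (- t) Z"
  by (erule hermitian_diagonalization) (simp add: hexp_udiag adj_udiag cis_cnj)

lemma hexp_conj:
  assumes "hermitian Z" "V \<in> unitary_group"
  shows "hexp t (V ** Z ** adj V) = V ** hexp t Z ** adj V"
proof -
  obtain Q \<theta> where Q: "Q \<in> unitary_group" "Z = udiag Q (\<lambda>j. complex_of_real (\<theta> j))"
    using hermitian_diagonalization[OF assms(1)] by blast
  have eq: "V ** udiag Q d ** adj V = udiag (V ** Q) d" for d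
    by (simp add: udiag_def adj_mult matrix_mul_assoc)
  show ?thesis
    using Q assms(2) by (simp add: eq hexp_udiag unitary_mult)
qed

lemma hexp_commute:
  assumes "hermitian Z" "A ** Z = Z ** A"
  shows "A ** hexp t Z = hexp t Z ** A"
proof -
  obtain Q \<theta> where Q: "Q \<in> unitary_group" "Z = udiag Q (\<lambda>j. complex_of_real (\<theta> j))"
    using hermitian_diagonalization[OF assms(1)] by blast
  show ?thesis
    using intertwine_udiag[OF Q(1) Q(1), of "\<lambda>j. complex_of_real (\<theta> j)" A "\<lambda>j. complex_of_real (\<theta> j)"
        "\<lambda>j. cis (t * \<theta> j)" "\<lambda>j. cis (t * \<theta> j)"] assms(2)
    by (simp add: Q hexp_udiag)
qed

lemma hexp_has_vector_derivative:
  fixes Z :: "('n::finite) cmatrix"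
  assumes "hermitian Z"
  shows "((\<lambda>t. hexp t Z) has_vector_derivative cscale \<i> Z ** hexp t Z) (at t within S)"
proof -
  obtain Q \<theta> where Q: "Q \<in> unitary_group" "Z = udiag Q (\<lambda>j. complex_of_real (\<theta> j))"
    using hermitian_diagonalization[OF assms(1)] by blast
  have entry: "((\<lambda>t. cis (t * \<theta> j)) has_vector_derivative \<i> * complex_of_real (\<theta> j) * cis (t * \<theta> j)) (at t within S)" for j
    by (auto simp: has_vector_derivative_complex_iff cis.ctr complex_eq_iff intro!: derivative_eq_intros)
  have "((\<lambda>t. diag_mat (\<lambda>j. cis (t * \<theta> j))) has_vector_derivative
      diag_mat (\<lambda>j. \<i> * complex_of_real (\<theta> j) * cis (t * \<theta> j))) (at t within S)"
  proof -
    \<comment> \<open>With fixed matrices and scalar coefficients, the derivative reduces to that of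
      each \<open>cis (t * \<theta> j)\<close>.\<close>
    have diag_sum: "diag_mat d = (\<Sum>k\<in>UNIV. cscale (d k) (diag_mat (\<lambda>j. if j = k then 1 else 0)))"
      for d :: "'n \<Rightarrow> complex"
    proof -
      have "(\<Sum>k\<in>UNIV. cscale (d k) (diag_mat (\<lambda>j. if j = k then 1 else 0))) $ i $ j
          = (\<Sum>k\<in>UNIV. if i = k then (if i = j then d k else 0) else 0)" for i j
        unfolding sum_component by (rule sum.cong) (auto simp: diag_entry cscale_def)
      then show ?thesis by (simp add: vec_eq_iff diag_entry)
    qed
    show ?thesis
      by (subst (1 2) diag_sum, rule has_vector_derivative_sum, rule bounded_linear.has_vector_derivative[OF bounded_linear_cscale_left], rule entry)
  qed
  from has_vector_derivative_matrix_mult[OF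
      has_vector_derivative_matrix_mult[OF has_vector_derivative_const this] has_vector_derivative_const]
  have "((\<lambda>t. udiag Q (\<lambda>j. cis (t * \<theta> j))) has_vector_derivative
      udiag Q (\<lambda>j. \<i> * complex_of_real (\<theta> j) * cis (t * \<theta> j))) (at t within S)"
    unfolding udiag_def by simp
  then show ?thesis
    using Q by (simp add: hexp_udiag udiag_cscale udiag_mult)
qed

lemma hermitian_add: "hermitian A \<Longrightarrow> hermitian B \<Longrightarrow> hermitian (A + B)"
  by (simp add: hermitian_def adj_add)

lemma hermitian_scaleR: "hermitian A \<Longrightarrow> hermitian (r *\<^sub>R A)"
  by (simp add: hermitian_def adj_scaleR)

lemma hermitian_minus: "hermitian A \<Longrightarrow> hermitian (- A)"
  using hermitian_scaleR[of A "-1"] by simp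

lemma hermitian_conj: "hermitian A \<Longrightarrow> hermitian (V ** A ** adj V)"
  by (simp add: hermitian_def adj_mult matrix_mul_assoc)

text \<open>A differential equation takes the place of simultaneous diagonalization: exp (- i t (A +
  B)) exp (i t A) exp (i t B) has derivative zero and starts at the identity.\<close>

lemma hexp_commuting_add:
  fixes A B :: "('n::finite) cmatrix"
  assumes A: "hermitian A" and B: "hermitian B" and AB: "A ** B = B ** A"
  shows "hexp t (A + B) = hexp t A ** hexp t B"
proof -
  let ?C = "A + B"
  have C: "hermitian ?C" by (intro hermitian_add A B)
  define g where "g t = hexp t (- ?C) ** hexp t A ** hexp t B" for t
  have "(g has_vector_derivative 0) (at t within UNIV)" for t
  proof -
    let ?E = "hexp t (- ?C)" and ?F = "hexp t A" and ?G = "hexp t B"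
    have E: "?E ** - ?C = - ?C ** ?E"
      by (rule hexp_commute[symmetric, OF hermitian_minus[OF C] refl])
    have F: "?F ** B = B ** ?F"
      by (rule hexp_commute[symmetric]) (simp_all add: A AB)
    have "((\<lambda>t. hexp t (- ?C) ** hexp t A ** hexp t B) has_vector_derivative
       ?E ** ?F ** (cscale \<i> B ** ?G) + (?E ** (cscale \<i> A ** ?F) + cscale \<i> (- ?C) ** ?E ** ?F) ** ?G) (at t)"
      by (intro has_vector_derivative_matrix_mult hexp_has_vector_derivative hermitian_minus A B C)
    also have "?E ** ?F ** (cscale \<i> B ** ?G) + (?E ** (cscale \<i> A ** ?F) + cscale \<i> (- ?C) ** ?E ** ?F) ** ?G
      = cscale \<i> (?E ** (?F ** B) ** ?G + (?E ** A ** ?F + (- ?C ** ?E) ** ?F) ** ?G)"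
      by (simp add: cscale_mult_left cscale_mult_right cscale_add matrix_mul_assoc matrix_add_rdistrib)
    also have "?E ** (?F ** B) ** ?G + (?E ** A ** ?F + (- ?C ** ?E) ** ?F) ** ?G
      = ?E ** (B + A + - ?C) ** ?F ** ?G"
      by (simp only: F E[symmetric] matrix_mul_assoc matrix_add_ldistrib matrix_add_rdistrib add.assoc)
    also have "\<dots> = 0" by simp
    finally show ?thesis by (simp add: g_def[abs_def])
  qed
  then obtain c where c: "\<And>t. g t = c"
    using has_vector_derivative_zero_constant[of UNIV g] by auto
  have "g t = mat 1"
    using c[of t] c[of 0] hexp_zero[OF hermitian_minus[OF C]] by (simp add: g_def hexp_zero A B)
  then have "adj (hexp t ?C) ** (hexp t A ** hexp t B) = mat 1"
    by (simp add: g_def hexp_minus[symmetric] adj_hexp C matrix_mul_assoc)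
  then show ?thesis
    using unitary_hexp[OF C, of t] by (metis matrix_mul_rid unitary_cancel(2))
qed

section \<open>The spectral norm\<close>

lemma norm_unitary: "U \<in> unitary_group \<Longrightarrow> norm (U *v x) = norm x"
proof -
  assume "U \<in> unitary_group"
  then have "cinner (U *v x) (U *v x) = cinner x x"
    by (simp add: cinner_adj matrix_vector_mul_assoc unitaryD)
  then show ?thesis
    by (metis Re_cinner norm_eq_sqrt_inner)
qed

lemma bounded_linear_matrix_vector: "bounded_linear (\<lambda>x. A *v x)" for A :: "('n::finite) cmatrix"
  by (simp add: linear_conv_bounded_linear[symmetric] linear_iff matrix_vector_right_distrib)
    (simp add: matrix_vector_mult_def vec_eq_iff scaleR_sum_right)

lemma diag_vector_entry: "(diag_mat d *v x) $ i = d i * x $ i"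
  by (simp add: matrix_vector_mult_def diag_entry if_distrib[where f="\<lambda>x. x * _"] cong: if_cong)

lemma norm_diag_vector_le:
  assumes "\<And>j. cmod (d j) \<le> c"
  shows "norm (diag_mat d *v x) \<le> c * norm x"
proof -
  \<comment> \<open>Any index serves; \<open>undefined\<close> is merely some element of the index
    type.\<close>
  have c: "c \<ge> 0" using assms[of undefined] by (meson norm_ge_zero order_trans)
  have "norm (diag_mat d *v x) \<le> norm (c *\<^sub>R x)"
    using assms c by (intro norm_le_componentwise_cart) (simp add: diag_vector_entry norm_mult mult_right_mono)
  then show ?thesis using c by simp
qed

text \<open>The images under \<open>Q\<close> of the basis vectors are eigenvectors and give one
  direction; the isometry \<open>Q\<close> reduces the other to a componentwise bound.\<close>

lemma spectral_norm_udiag_le: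
  assumes Q: "Q \<in> unitary_group" and "c \<ge> 0"
  shows "spectral_norm (udiag Q d) \<le> c \<longleftrightarrow> (\<forall>j. cmod (d j) \<le> c)"
proof
  assume *: "spectral_norm (udiag Q d) \<le> c"
  show "\<forall>j. cmod (d j) \<le> c"
  proof
    fix j
    define e where "e = (axis j 1 :: complex^'a)"
    have e: "norm e = 1" by (simp add: e_def)
    have "udiag Q d *v (Q *v e) = Q *v (diag_mat d *v e)"
      using Q by (simp add: udiag_def matrix_vector_mul_assoc matrix_mul_assoc[symmetric] unitaryD)
    then have "norm (diag_mat d *v e) = norm (udiag Q d *v (Q *v e))"
      using Q by (simp add: norm_unitary)
    also have "\<dots> \<le> spectral_norm (udiag Q d) * norm (Q *v e)"
      unfolding spectral_norm_def by (rule onorm[OF bounded_linear_matrix_vector])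
    also have "\<dots> \<le> c" using * Q e by (simp add: norm_unitary)
    finally have "norm (diag_mat d *v e) \<le> c" .
    moreover have "(diag_mat d *v e) $ j = d j"
      by (simp add: e_def diag_vector_entry axis_def)
    ultimately show "cmod (d j) \<le> c"
      by (metis Finite_Cartesian_Product.norm_nth_le order_trans)
  qed
next
  assume "\<forall>j. cmod (d j) \<le> c"
  then have d: "\<And>j. cmod (d j) \<le> c" by simp
  show "spectral_norm (udiag Q d) \<le> c"
    unfolding spectral_norm_def
  proof (rule onorm_le)
    fix x
    have "norm (udiag Q d *v x) = norm (Q *v (diag_mat d *v (adj Q *v x)))"
      by (simp add: udiag_def matrix_vector_mul_assoc matrix_mul_assoc)
    also have "\<dots> \<le> c * norm x"
      using norm_diag_vector_le[OF d, where x="adj Q *v x"] Q by (simp add: norm_unitary unitary_adj)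
    finally show "norm (udiag Q d *v x) \<le> c * norm x" .
  qed
qed

lemma spectral_norm_udiag:
  assumes "Q \<in> unitary_group"
  shows "spectral_norm (udiag Q d) = Max (range (\<lambda>j. cmod (d j)))"
proof -
  have pos: "0 \<le> spectral_norm (udiag Q d)"
    unfolding spectral_norm_def by (rule onorm_pos_le[OF bounded_linear_matrix_vector])
  have M: "0 \<le> Max (range (\<lambda>j. cmod (d j)))"
    by (auto simp: Max_ge_iff)
  have "spectral_norm (udiag Q d) \<le> Max (range (\<lambda>j. cmod (d j)))"
    using spectral_norm_udiag_le[OF assms M] by simp
  moreover have "Max (range (\<lambda>j. cmod (d j))) \<le> spectral_norm (udiag Q d)"
    using spectral_norm_udiag_le[OF assms pos, of d] by auto
  ultimately show ?thesis by simp
qed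

lemma spectral_norm_unitary_mult: "U \<in> unitary_group \<Longrightarrow> spectral_norm (U ** A) = spectral_norm A"
  by (simp add: spectral_norm_def onorm_def matrix_vector_mul_assoc[symmetric] norm_unitary)

section \<open>Principal arguments\<close>

text \<open>The representative modulo 2 \<pi> in the half-open interval from -\<pi> to \<pi>. It
  depends on \<open>cis \<theta>\<close> alone, hence only on the exponential; the price is that
  -\<pi> is sent to \<pi>.\<close>

definition parg :: "real \<Rightarrow> real" where
  "parg \<theta> = Arg (cis \<theta>)"

lemma cis_parg [simp]: "cis (parg \<theta>) = cis \<theta>"
  by (simp add: parg_def cis_Arg sgn_if)

lemma parg_eq: "\<bar>\<theta>\<bar> < pi \<Longrightarrow> parg \<theta> = \<theta>"
  unfolding parg_def by (rule cis_Arg_unique) auto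

lemma abs_parg_le_pi: "\<bar>parg \<theta>\<bar> \<le> pi"
  unfolding parg_def using Arg_bounded[of "cis \<theta>"] by auto

lemma Arg_minus_one: "Arg (- 1) = pi"
  by (rule cis_Arg_unique) (auto simp: complex_eq_iff)

lemma abs_parg_eq_pi_iff: "\<bar>parg \<theta>\<bar> = pi \<longleftrightarrow> cis \<theta> = - 1"
proof
  assume "\<bar>parg \<theta>\<bar> = pi"
  then have "parg \<theta> = pi \<or> parg \<theta> = - pi" by linarith
  then have "cis (parg \<theta>) = - 1" by (auto simp: cis.ctr complex_eq_iff)
  then show "cis \<theta> = - 1" by simp
qed (simp add: parg_def Arg_minus_one)

text \<open>Only moduli are compared because -\<pi> changes sign; the monotonicity of \<phi> needs
  no more.\<close>

lemma abs_parg_eq: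
  assumes "\<bar>\<theta>\<bar> \<le> pi"
  shows "\<bar>parg \<theta>\<bar> = \<bar>\<theta>\<bar>"
proof (cases "\<bar>\<theta>\<bar> < pi")
  case False
  then have "\<theta> = pi \<or> \<theta> = - pi" using assms by linarith
  then have "cis \<theta> = - 1" by (auto simp: cis.ctr complex_eq_iff)
  then have "\<bar>parg \<theta>\<bar> = pi" by (simp add: abs_parg_eq_pi_iff)
  then show ?thesis using \<open>\<theta> = pi \<or> \<theta> = - pi\<close> by auto
qed (simp add: parg_eq)

lemma abs_parg_le: "\<bar>parg \<theta>\<bar> \<le> \<bar>\<theta>\<bar>"
  using abs_parg_eq[of \<theta>] abs_parg_le_pi[of \<theta>] by linarith

lemma cmod_one_minus_cis_less_2:
  assumes "\<bar>\<theta>\<bar> \<le> pi"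
  shows "cmod (1 - cis \<theta>) < 2 \<longleftrightarrow> \<bar>\<theta>\<bar> < pi"
proof -
  have "(cmod (1 - cis \<theta>))\<^sup>2 = (1 - cos \<theta>)\<^sup>2 + (sin \<theta>)\<^sup>2"
    by (simp add: cmod_power2)
  also have "\<dots> = 2 - 2 * cos \<theta>"
    using sin_cos_squared_add[of \<theta>] by (simp add: power2_eq_square algebra_simps)
  finally have "cmod (1 - cis \<theta>) < 2 \<longleftrightarrow> cos pi < cos \<bar>\<theta>\<bar>"
    using power2_less_imp_less[of "cmod (1 - cis \<theta>)" 2] power_strict_mono[of "cmod (1 - cis \<theta>)" 2 2]
    by auto
  also have "\<dots> \<longleftrightarrow> \<bar>\<theta>\<bar> < pi"
    using assms by (intro cos_mono_less_eq) auto
  finally show ?thesis .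
qed

section \<open>Unitarily invariant norms\<close>

text \<open>The two points have the angles Arg r + \<alpha> and Arg r - \<alpha>, where cos \<alpha>
  is the modulus of \<open>r\<close>.\<close>

lemma contraction_midpoint:
  assumes "cmod r \<le> 1"
  shows "\<exists>u v. cmod u = 1 \<and> cmod v = 1 \<and> r = (u + v) / 2"
proof -
  define \<alpha> where "\<alpha> = arccos (cmod r)"
  have "cos \<alpha> = cmod r" using assms norm_ge_zero[of r] unfolding \<alpha>_def by (intro cos_arccos) linarith+
  then have "cis \<alpha> + cis (- \<alpha>) = 2 * complex_of_real (cmod r)"
    by (simp add: complex_eq_iff)
  then have "cis (Arg r) * cis \<alpha> + cis (Arg r) * cis (- \<alpha>) = 2 * (complex_of_real (cmod r) * cis (Arg r))"
    by (metis distrib_left mult.commute mult.left_commute)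
  also have "complex_of_real (cmod r) * cis (Arg r) = r"
    using rcis_cmod_Arg[of r] by (simp add: rcis_def)
  finally show ?thesis
    by (intro exI[of _ "cis (Arg r) * cis \<alpha>"] exI[of _ "cis (Arg r) * cis (- \<alpha>)"]) (simp add: norm_mult)
qed

text \<open>Known as pinching: the block diagonal part for the partition of the indices into level
  sets of \<open>f\<close>, whose members need not be consecutive.\<close>

definition pinch :: "('n \<Rightarrow> 'a) \<Rightarrow> 'n cmatrix \<Rightarrow> ('n::finite) cmatrix" where
  "pinch f X = (\<chi> i j. if f i = f j then X $ i $ j else 0)"

locale ui_norm =
  fixes \<phi> :: "('n::finite) cmatrix \<Rightarrow> real"
  assumes norm: "is_norm \<phi>" and invariant: "unitarily_invariant \<phi>"
begin

lemma nonneg: "\<phi> A \<ge> 0"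
  using norm by (simp add: is_norm_def)

lemma eq_0_iff: "\<phi> A = 0 \<longleftrightarrow> A = 0"
  using norm by (simp add: is_norm_def)

lemma zero [simp]: "\<phi> 0 = 0"
  by (simp add: eq_0_iff)

lemma cscale: "\<phi> (cscale c A) = cmod c * \<phi> A"
  using norm by (simp add: is_norm_def)

lemma triangle: "\<phi> (A + B) \<le> \<phi> A + \<phi> B"
  using norm by (simp add: is_norm_def)

lemma scaleR: "\<phi> (r *\<^sub>R A) = \<bar>r\<bar> * \<phi> A"
  using cscale[of "complex_of_real r" A] by (simp add: cscale_of_real)

lemma minus: "\<phi> (- A) = \<phi> A"
  using scaleR[of "-1" A] by simp

lemma diff_commute: "\<phi> (A - B) = \<phi> (B - A)"
  using minus[of "A - B"] by simp

lemma diff_triangle: "\<phi> (A - C) \<le> \<phi> (A - B) + \<phi> (B - C)"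
  using triangle[of "A - B" "B - C"] by simp

lemma abs_diff_le: "\<bar>\<phi> A - \<phi> B\<bar> \<le> \<phi> (A - B)"
  using triangle[of "A - B" B] triangle[of "B - A" A] diff_commute[of A B] by simp

lemma unitary_left: "U \<in> unitary_group \<Longrightarrow> \<phi> (U ** A) = \<phi> A"
  using invariant unitary_one unfolding unitarily_invariant_def by (metis matrix_mul_rid)

lemma unitary_right: "U \<in> unitary_group \<Longrightarrow> \<phi> (A ** U) = \<phi> A"
  using invariant unitary_one unfolding unitarily_invariant_def by (metis matrix_mul_lid)

lemma unitary_conj: "U \<in> unitary_group \<Longrightarrow> \<phi> (U ** A ** adj U) = \<phi> A"
  by (simp add: unitary_left unitary_right unitary_adj)

lemma udiag: "Q \<in> unitary_group \<Longrightarrow> \<phi> (udiag Q d) = \<phi> (diag_mat d)"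
  unfolding udiag_def by (rule unitary_conj)

text \<open>Expansion in the matrix units \<open>E i j\<close>. It provides the continuity of \<phi>
  and lets \<phi> measure first order errors.\<close>

lemma norm_bound: "\<exists>C>0. \<forall>A. \<phi> A \<le> C * norm A"
proof -
  define E where "E i j = (\<chi> k l. if k = i \<and> l = j then 1 else (0::complex))" for i j :: 'n
  have A: "A = (\<Sum>i\<in>UNIV. \<Sum>j\<in>UNIV. cscale (A $ i $ j) (E i j))" for A
  proof -
    have "(\<Sum>i\<in>UNIV. \<Sum>j\<in>UNIV. cscale (A $ i $ j) (E i j)) $ k $ l
       = (\<Sum>i\<in>UNIV. if k = i then (\<Sum>j\<in>UNIV. if l = j then A $ i $ j else 0) else 0)" for k l
      unfolding sum_component
      by (rule sum.cong) (auto simp: E_def cscale_def mult_delta_right)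
    then show ?thesis by (simp add: vec_eq_iff)
  qed
  have sum_le: "\<phi> (\<Sum>i\<in>I. f i) \<le> (\<Sum>i\<in>I. \<phi> (f i))" if "finite I" for f and I :: "'n set"
    using that by induction (auto intro: order_trans[OF triangle])
  define C where "C = (\<Sum>i\<in>UNIV. \<Sum>j\<in>UNIV. \<phi> (E i j))"
  have "\<phi> A \<le> (C + 1) * norm A" for A
  proof -
    have "\<phi> A \<le> (\<Sum>i\<in>UNIV. \<Sum>j\<in>UNIV. \<phi> (cscale (A $ i $ j) (E i j)))"
      by (subst A) (intro order_trans[OF sum_le] sum_mono order_trans[OF sum_le], simp_all)
    also have "\<dots> \<le> (\<Sum>i\<in>UNIV. \<Sum>j\<in>UNIV. norm A * \<phi> (E i j))"
      by (intro sum_mono) (simp add: cscale mult_right_mono norm_entry_le nonneg)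
    also have "\<dots> = C * norm A" by (simp add: C_def sum_distrib_left[symmetric])
    also have "\<dots> \<le> (C + 1) * norm A" by (intro mult_right_mono) auto
    finally show ?thesis .
  qed
  moreover have "C + 1 > 0"
    unfolding C_def by (intro add_nonneg_pos sum_nonneg nonneg) auto
  ultimately show ?thesis by blast
qed

lemma continuous_on_norm [continuous_intros]:
  assumes "continuous_on S f"
  shows "continuous_on S (\<lambda>x. \<phi> (f x))"
proof -
  obtain C where C: "C > 0" "\<And>A. \<phi> A \<le> C * norm A" using norm_bound by blast
  have "C-lipschitz_on UNIV \<phi>"
  proof (rule lipschitz_onI)
    fix A B
    show "dist (\<phi> A) (\<phi> B) \<le> C * dist A B"
      using abs_diff_le[of A B] C(2)[of "A - B"] by (simp add: dist_norm)
  qed (use C in simp)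
  then have "continuous_on UNIV \<phi>" by (rule lipschitz_on_continuous_on)
  then show ?thesis using assms by (rule continuous_on_compose2) simp
qed

text \<open>Equal norms force the factor \<open>s\<close> to be 1 unless both matrices vanish. It
  will be applied to two points of one unitary orbit.\<close>

lemma strict_midpoint:
  assumes "strictly_convex_norm \<phi>" "\<phi> A = \<phi> B" "\<phi> (A + B) = \<phi> A + \<phi> B"
  shows "A = B"
proof -
  from assms(1,3) obtain s where s: "s \<ge> 0" "A = s *\<^sub>R B \<or> B = s *\<^sub>R A"
    unfolding strictly_convex_norm_def by blast
  from s(2) show ?thesis
  proof
    assume "A = s *\<^sub>R B"
    then show ?thesis using assms(2) s(1) eq_0_iff[of B] by (auto simp: scaleR)
  next
    assume "B = s *\<^sub>R A"
    then show ?thesis using assms(2) s(1) eq_0_iff[of A] by (auto simp: scaleR)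
  qed
qed

text \<open>Each \<open>c j\<close> is the mean of \<open>d j * u j\<close> and
  \<open>d j * v j\<close> with unimodular \<open>u j\<close>, \<open>v j\<close>, so
  \<open>diag_mat c\<close> is the midpoint of two unitary multiples of \<open>diag_mat d\<close>.
  In the strict case these coincide, and each \<open>c j\<close> is then a unimodular multiple of
  \<open>d j\<close>.\<close>

lemma diag_mono_aux:
  assumes "\<And>j. cmod (c j) \<le> cmod (d j)"
  shows "\<phi> (diag_mat c) \<le> \<phi> (diag_mat d)"
    and "strictly_convex_norm \<phi> \<Longrightarrow> \<phi> (diag_mat c) = \<phi> (diag_mat d) \<Longrightarrow> cmod (c j) = cmod (d j)"
proof -
  have "\<exists>u v. cmod u = 1 \<and> cmod v = 1 \<and> c j = (d j * u + d j * v) / 2" for j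
  proof (cases "d j = 0")
    case False
    then have "cmod (c j / d j) \<le> 1" using assms[of j] by (simp add: norm_divide divide_le_eq)
    from contraction_midpoint[OF this] obtain u v where
      "cmod u = 1 \<and> cmod v = 1 \<and> c j / d j = (u + v) / 2" by blast
    then show ?thesis using False
      by (intro exI[of _ u] exI[of _ v]) (simp add: field_simps)
  qed (use assms[of j] in \<open>auto intro: exI[of _ 1]\<close>)
  then obtain u v where u: "\<And>j. cmod (u j) = 1" and v: "\<And>j. cmod (v j) = 1"
    and c: "\<And>j. c j = (d j * u j + d j * v j) / 2" by metis
  let ?A = "diag_mat d ** diag_mat u" and ?B = "diag_mat d ** diag_mat v"
  have AB: "\<phi> ?A = \<phi> (diag_mat d)" "\<phi> ?B = \<phi> (diag_mat d)"
    by (simp_all add: unitary_right unitary_diag u v)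
  have cAB: "2 *\<^sub>R diag_mat c = ?A + ?B"
    by (simp add: diag_mult diag_add cscale_of_real[symmetric] diag_cscale c add_divide_distrib)
  then have "2 * \<phi> (diag_mat c) = \<phi> (?A + ?B)"
    by (metis scaleR abs_numeral)
  with triangle[of ?A ?B] AB show "\<phi> (diag_mat c) \<le> \<phi> (diag_mat d)" by simp
  assume "strictly_convex_norm \<phi>" "\<phi> (diag_mat c) = \<phi> (diag_mat d)"
  with AB \<open>2 * \<phi> (diag_mat c) = \<phi> (?A + ?B)\<close> have "?A = ?B"
    by (intro strict_midpoint) auto
  then have "d j * u j = d j * v j" unfolding diag_mult by (rule diag_inj)
  then have "c j = d j * u j" by (auto simp: c)
  then show "cmod (c j) = cmod (d j)" by (simp add: norm_mult u)
qed

lemmas diag_mono = diag_mono_aux(1)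
lemmas diag_mono_strict = diag_mono_aux(2)

text \<open>Conjugation by the reflection \<open>R\<close> changes the sign of the off-diagonal
  blocks, so the pinching is the midpoint of \<open>X\<close> and
  \<open>R ** X ** R\<close>.\<close>

lemma pinch_bool:
  fixes f :: "'n \<Rightarrow> bool"
  shows "\<phi> (pinch f X) \<le> \<phi> X"
    and "strictly_convex_norm \<phi> \<Longrightarrow> \<phi> (pinch f X) = \<phi> X \<Longrightarrow> pinch f X = X"
proof -
  define R :: "'n cmatrix" where "R = diag_mat (\<lambda>i. if f i then 1 else - 1)"
  have R: "R \<in> unitary_group" unfolding R_def by (rule unitary_diag) simp
  have P: "2 *\<^sub>R pinch f X = X + R ** X ** R"
    by (simp add: vec_eq_iff pinch_def R_def diag_mult_right diag_mult_left scaleR_2)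
  then have "2 * \<phi> (pinch f X) = \<phi> (X + R ** X ** R)"
    by (metis scaleR abs_numeral)
  moreover have eq: "\<phi> (R ** X ** R) = \<phi> X" by (simp add: unitary_left unitary_right R)
  ultimately show "\<phi> (pinch f X) \<le> \<phi> X" using triangle[of X "R ** X ** R"] by simp
  assume "strictly_convex_norm \<phi>" "\<phi> (pinch f X) = \<phi> X"
  with \<open>2 * \<phi> (pinch f X) = \<phi> (X + R ** X ** R)\<close> eq have "X = R ** X ** R"
    by (intro strict_midpoint) auto
  then have "2 *\<^sub>R pinch f X = 2 *\<^sub>R X" using P by (simp add: scaleR_2)
  then show "pinch f X = X" by simp
qed

lemma pinch:
  fixes f :: "'n \<Rightarrow> 'a"
  shows "\<phi> (pinch f X) \<le> \<phi> X"
    and "strictly_convex_norm \<phi> \<Longrightarrow> \<phi> (pinch f X) = \<phi> X \<Longrightarrow> pinch f X = X"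
proof -
  \<comment> \<open>\<open>g A i\<close> records which members of \<open>A\<close> share the value
    of \<open>i\<close>. Adding one index to \<open>A\<close> is one more two-block pinching, and
    for \<open>A = UNIV\<close> the level sets are those of \<open>f\<close>.\<close>
  define g where "g A i = (\<lambda>l. l \<in> A \<and> f i = f l)" for A and i :: 'n
  have "\<phi> (pinch (g A) X) \<le> \<phi> X \<and>
    (strictly_convex_norm \<phi> \<longrightarrow> \<phi> (pinch (g A) X) = \<phi> X \<longrightarrow> pinch (g A) X = X)" (is "?P A")
    if "finite A" for A
    using that
  proof induction
    case empty
    show ?case by (simp add: g_def pinch_def)
  next
    case (insert l A)
    have "pinch (g (insert l A)) X = pinch (\<lambda>i. f i = f l) (pinch (g A) X)"
      using insert.hyps by (auto simp: pinch_def vec_eq_iff g_def fun_eq_iff)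
    then show ?case
      using insert.IH pinch_bool[of "\<lambda>i. f i = f l" "pinch (g A) X"] by force
  qed
  from this[of UNIV] have "?P UNIV" by simp
  moreover have "pinch (g UNIV) X = pinch f X"
    by (auto simp: pinch_def vec_eq_iff g_def fun_eq_iff)
  ultimately show "\<phi> (pinch f X) \<le> \<phi> X"
    and "strictly_convex_norm \<phi> \<Longrightarrow> \<phi> (pinch f X) = \<phi> X \<Longrightarrow> pinch f X = X"
    by auto
qed

end

lemma udiag_inj:
  assumes "Q \<in> unitary_group" "udiag Q c = udiag Q d"
  shows "c j = d j"
proof (rule diag_inj)
  have "adj Q ** udiag Q c ** Q = adj Q ** udiag Q d ** Q" by (simp add: assms(2))
  then show "diag_mat c = diag_mat d"
    using assms(1) by (simp add: udiag_def matrix_mul_assoc[symmetric] unitary_cancel unitaryD)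
qed

text \<open>The identity intertwines the two diagonal forms of the common exponential, so a function
  of the angles that factors through \<open>cis\<close> gives the same matrix in either
  eigenbasis.\<close>

lemma intertwine_hexp:
  assumes "Q \<in> unitary_group" "Q' \<in> unitary_group"
    and "hexp 1 (udiag Q (\<lambda>j. complex_of_real (\<theta> j))) = hexp 1 (udiag Q' (\<lambda>j. complex_of_real (\<theta>' j)))"
    and "\<And>x y. cis x = cis y \<Longrightarrow> f x = f y"
  shows "udiag Q (\<lambda>j. f (\<theta> j)) = udiag Q' (\<lambda>j. f (\<theta>' j))"
proof -
  have "udiag Q (\<lambda>j. f (\<theta> j)) ** mat 1 = mat 1 ** udiag Q' (\<lambda>j. f (\<theta>' j))"
  proof (rule intertwine_udiag[OF assms(1,2)])
    show "udiag Q (\<lambda>j. cis (\<theta> j)) ** mat 1 = mat 1 ** udiag Q' (\<lambda>j. cis (\<theta>' j))"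
      using assms(1-3) by (simp add: hexp_udiag)
  qed (rule assms(4))
  then show ?thesis by simp
qed

text \<open>Differentiating \<open>adj (\<gamma> t) ** \<gamma> t = mat 1\<close> shows that
  \<open>adj (\<gamma> s) ** D\<close> is skew-Hermitian; at the ends of the interval the derivative
  is one-sided.\<close>

lemma unitary_velocity:
  fixes \<gamma> :: "real \<Rightarrow> ('n::finite) cmatrix"
  assumes "(\<gamma> has_vector_derivative D) (at s within {p..q})" "s \<in> {p..q}" "p < q"
    and U: "\<And>t. t \<in> {p..q} \<Longrightarrow> \<gamma> t \<in> unitary_group"
  shows "hermitian (cscale (- \<i>) (adj (\<gamma> s) ** D))"
proof -
  have "((\<lambda>t. adj (\<gamma> t) ** \<gamma> t) has_vector_derivative adj (\<gamma> s) ** D + adj D ** \<gamma> s) (at s within {p..q})"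
    by (intro has_vector_derivative_matrix_mult bounded_linear.has_vector_derivative[OF bounded_linear_adj] assms)
  moreover have "((\<lambda>t. adj (\<gamma> t) ** \<gamma> t) has_vector_derivative 0) (at s within {p..q})"
    by (rule has_vector_derivative_transform[where f="\<lambda>_. mat 1"]) (use assms in \<open>auto simp: unitaryD\<close>)
  ultimately have "adj (\<gamma> s) ** D + adj D ** \<gamma> s = 0"
    using vector_derivative_unique_within_closed_interval[of p q s] assms(2,3) by auto
  then have "adj D ** \<gamma> s = - (adj (\<gamma> s) ** D)"
    by (simp add: eq_neg_iff_add_eq_0 add.commute)
  then show ?thesis
    by (simp add: hermitian_def adj_cscale adj_mult) (simp add: cscale_def vec_eq_iff)
qed

lemma hexp_shift_has_vector_derivative:
  assumes "hermitian K"
  shows "((\<lambda>t. hexp (t - s) K) has_vector_derivative cscale \<i> K ** hexp (x - s) K) (at x within S)"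
proof -
  have "((\<lambda>t. hexp t K ** hexp (- s) K) has_vector_derivative
      hexp x K ** 0 + cscale \<i> K ** hexp x K ** hexp (- s) K) (at x within S)"
    by (intro has_vector_derivative_matrix_mult hexp_has_vector_derivative assms has_vector_derivative_const)
  then show ?thesis
    by (simp add: hexp_add[OF assms, symmetric] matrix_mul_assoc[symmetric])
qed

context ui_norm
begin

section \<open>Logarithms of minimal norm\<close>

text \<open>Both matrices are compared with the logarithm built from \<open>parg\<close>, which
  depends on the exponential alone: its eigenvalues have the moduli of those of \<open>Z\<close>,
  and at most the moduli of those of \<open>Z'\<close>.\<close>

lemma minimal_log:
  assumes "hermitian Z" "hermitian Z'" "spectral_norm Z \<le> pi" "hexp 1 Z = hexp 1 Z'"
  shows "\<phi> Z \<le> \<phi> Z'"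
proof -
  obtain Q \<theta> where Q: "Q \<in> unitary_group" and Z: "Z = udiag Q (\<lambda>j. complex_of_real (\<theta> j))"
    using hermitian_diagonalization[OF assms(1)] by blast
  obtain Q' \<theta>' where Q': "Q' \<in> unitary_group" and Z': "Z' = udiag Q' (\<lambda>j. complex_of_real (\<theta>' j))"
    using hermitian_diagonalization[OF assms(2)] by blast
  have \<theta>: "\<bar>\<theta> j\<bar> \<le> pi" for j
    using assms(3) by (simp add: Z spectral_norm_udiag_le[OF Q])
  have "\<phi> Z = \<phi> (diag_mat (\<lambda>j. complex_of_real (\<theta> j)))" by (simp add: Z udiag Q)
  also have "\<dots> \<le> \<phi> (diag_mat (\<lambda>j. complex_of_real (parg (\<theta> j))))"
    by (rule diag_mono) (simp add: abs_parg_eq \<theta>)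
  also have "\<dots> = \<phi> (udiag Q (\<lambda>j. complex_of_real (parg (\<theta> j))))" by (simp add: udiag Q)
  also have "udiag Q (\<lambda>j. complex_of_real (parg (\<theta> j))) = udiag Q' (\<lambda>j. complex_of_real (parg (\<theta>' j)))"
    by (rule intertwine_hexp[OF Q Q' assms(4)[unfolded Z Z']]) (simp add: parg_def)
  also have "\<phi> \<dots> = \<phi> (diag_mat (\<lambda>j. complex_of_real (parg (\<theta>' j))))" by (simp add: udiag Q')
  also have "\<dots> \<le> \<phi> (diag_mat (\<lambda>j. complex_of_real (\<theta>' j)))"
    by (rule diag_mono) (simp add: abs_parg_le)
  also have "\<dots> = \<phi> Z'" by (simp add: Z' udiag Q')
  finally show ?thesis .
qed

lemma minimal_log_unique:
  assumes strict: "strictly_convex_norm \<phi>"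
    and "hermitian Z" "hermitian Z'" "spectral_norm Z < pi" "hexp 1 Z = hexp 1 Z'" "\<phi> Z' \<le> \<phi> Z"
  shows "Z' = Z"
proof -
  obtain Q \<theta> where Q: "Q \<in> unitary_group" and Z: "Z = udiag Q (\<lambda>j. complex_of_real (\<theta> j))"
    using hermitian_diagonalization[OF assms(2)] by blast
  obtain Q' \<theta>' where Q': "Q' \<in> unitary_group" and Z': "Z' = udiag Q' (\<lambda>j. complex_of_real (\<theta>' j))"
    using hermitian_diagonalization[OF assms(3)] by blast
  have \<theta>: "\<bar>\<theta> j\<bar> < pi" for j
    using assms(4) by (simp add: Z spectral_norm_udiag[OF Q])
  note transfer = intertwine_hexp[OF Q Q' assms(5)[unfolded Z Z']]
  \<comment> \<open>This is the spectral projection of the exponential for -1. It vanishes because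
    the angles of \<open>Z\<close> stay below \<pi>, so no angle of \<open>Z'\<close> is an odd
    multiple of \<pi>.\<close>
  have "udiag Q (\<lambda>j. if cis (\<theta> j) = - 1 then 1 else 0) = udiag Q' (\<lambda>j. if cis (\<theta>' j) = - 1 then 1 else 0)"
    by (rule transfer) simp
  moreover have "cis (\<theta> j) \<noteq> - 1" for j
    using \<theta>[of j] by (metis abs_parg_eq_pi_iff order_less_irrefl parg_eq)
  ultimately have "udiag Q' (\<lambda>j. if cis (\<theta>' j) = - 1 then 1 else 0) = udiag Q' (\<lambda>j. 0)"
    by (simp add: udiag_def diag_mat_def vec_eq_iff matrix_matrix_mult_def)
  then have "(if cis (\<theta>' j) = - 1 then 1 else 0) = (0::complex)" for j
    by (rule udiag_inj[OF Q'])
  then have "\<bar>parg (\<theta>' j)\<bar> < pi" for j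
    using abs_parg_eq_pi_iff[of "\<theta>' j"] abs_parg_le_pi[of "\<theta>' j"] by (metis order_le_less zero_neq_one)
  moreover
  have Zp: "Z = udiag Q' (\<lambda>j. complex_of_real (parg (\<theta>' j)))"
  proof -
    have "Z = udiag Q (\<lambda>j. complex_of_real (parg (\<theta> j)))" by (simp add: Z parg_eq \<theta>)
    also have "\<dots> = udiag Q' (\<lambda>j. complex_of_real (parg (\<theta>' j)))"
      by (rule transfer) (simp add: parg_def)
    finally show ?thesis .
  qed
  \<comment> \<open>Equality in the monotonicity of \<phi> gives equal moduli; the angles of
    \<open>Z'\<close> are thus below \<pi> in modulus and are their own principal arguments.\<close>
  have "cmod (complex_of_real (parg (\<theta>' j))) = cmod (complex_of_real (\<theta>' j))" for j
  proof (rule diag_mono_strict[OF _ strict])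
    show le: "cmod (complex_of_real (parg (\<theta>' j))) \<le> cmod (complex_of_real (\<theta>' j))" for j
      by (simp add: abs_parg_le)
    show "\<phi> (diag_mat (\<lambda>j. complex_of_real (parg (\<theta>' j)))) = \<phi> (diag_mat (\<lambda>j. complex_of_real (\<theta>' j)))"
    proof (rule antisym)
      show "\<phi> (diag_mat (\<lambda>j. complex_of_real (parg (\<theta>' j)))) \<le> \<phi> (diag_mat (\<lambda>j. complex_of_real (\<theta>' j)))"
        by (rule diag_mono) (rule le)
      show "\<phi> (diag_mat (\<lambda>j. complex_of_real (\<theta>' j))) \<le> \<phi> (diag_mat (\<lambda>j. complex_of_real (parg (\<theta>' j))))"
        using assms(6) by (simp add: Zp Z' udiag Q')
    qed
  qed
  ultimately have "parg (\<theta>' j) = \<theta>' j" for j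
    by (metis norm_of_real parg_eq real_norm_def)
  then show ?thesis by (simp add: Zp Z')
qed

text \<open>First order perturbation of eigenvalues: up to conjugation by \<open>exp (i h K)\<close>, the
  product \<open>exp (i Z) exp (i h X)\<close> agrees to first order with \<open>exp (i (Z + h P))\<close>, where \<open>P\<close> is
  the part of \<open>X\<close> commuting with \<open>exp (i Z)\<close>. The logarithm \<open>Z\<close> has to be replaced by the principal
  one, because only the latter commutes with everything that commutes with \<open>exp (i Z)\<close>.\<close>

lemma principal_log:
  fixes Z :: "'n cmatrix"
  assumes "hermitian Z"
  obtains Z' where "hermitian Z'" "hexp 1 Z' = hexp 1 Z" "\<phi> Z' \<le> \<phi> Z"
    "\<And>X. hermitian X \<Longrightarrow> \<exists>P K. hermitian P \<and> hermitian K \<and> Z' ** P = P ** Z' \<and>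
      K ** hexp 1 Z - hexp 1 Z ** K = hexp 1 Z ** (X - P) \<and> \<phi> P \<le> \<phi> X \<and>
      (strictly_convex_norm \<phi> \<longrightarrow> \<phi> P = \<phi> X \<longrightarrow> P = X)"
proof -
  obtain Q \<theta> where Q: "Q \<in> unitary_group" and Z: "Z = udiag Q (\<lambda>j. complex_of_real (\<theta> j))"
    using hermitian_diagonalization[OF assms] by blast
  let ?p = "\<lambda>j. complex_of_real (parg (\<theta> j))" and ?w = "\<lambda>j. cis (\<theta> j)"
  let ?c = "\<lambda>A. Q ** A ** adj Q"
  have W: "hexp 1 Z = ?c (diag_mat ?w)"
    by (simp add: Z hexp_udiag[OF Q]) (simp add: udiag_def)
  have cc: "?c A ** ?c B = ?c (A ** B)" for A B
    using Q by (simp add: matrix_mul_assoc[symmetric] unitary_cancel)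
  have cd: "?c A - ?c B = ?c (A - B)" for A B
    by (simp add: matrix_diff_ldistrib matrix_diff_rdistrib)
  show ?thesis
  proof (rule that[of "udiag Q ?p"])
    show "hermitian (udiag Q ?p)" by (rule hermitian_udiag)
    show "hexp 1 (udiag Q ?p) = hexp 1 Z" by (simp add: Z hexp_udiag[OF Q])
    show "\<phi> (udiag Q ?p) \<le> \<phi> Z"
      by (simp add: Z udiag Q) (rule diag_mono, simp add: abs_parg_le)
    fix X :: "'n cmatrix"
    assume X: "hermitian X"
    define B where "B = adj Q ** X ** Q"
    have XB: "X = ?c B"
      using Q by (simp add: B_def matrix_mul_assoc[symmetric] unitary_cancel unitaryD)
    have "hermitian B"
      using X by (simp add: B_def hermitian_def adj_mult matrix_mul_assoc)
    then have B: "cnj (B $ i $ j) = B $ j $ i" for i j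
      by (metis (no_types) hermitian_def conj_transpose_def vec_lambda_beta)
    \<comment> \<open>The blocks collect equal eigenvalues of exp (i Z), not of \<open>Z\<close>:
      angles differing by a multiple of 2 \<pi> share a block.\<close>
    define P where "P = pinch ?w B"
    \<comment> \<open>Off the blocks the commutator equation determines the entries, after division
      by \<open>?w j - ?w i\<close>; inside a block both of its sides vanish and 0 is
      chosen.\<close>
    define K where "K = (\<chi> i j. if ?w i = ?w j then 0 else ?w i * B $ i $ j / (?w j - ?w i))"
    have P: "hermitian P"
      by (simp add: hermitian_def conj_transpose_def P_def pinch_def vec_eq_iff B)
    have "cnj (K $ j $ i) = K $ i $ j" for i j
    proof (cases "?w i = ?w j")
      case False
      have w: "cnj (?w k) = 1 / ?w k" for k by (simp add: cis_cnj divide_inverse)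
      have nz: "?w k \<noteq> 0" for k by simp
      have "cnj (K $ j $ i) = (1 / ?w j) * B $ i $ j / (1 / ?w i - 1 / ?w j)"
        using False by (simp add: K_def B w)
      also have "\<dots> = ?w i * B $ i $ j / (?w j - ?w i)"
        using False nz[of i] nz[of j] by (simp add: divide_simps)
      finally show ?thesis using False by (simp add: K_def)
    qed (simp add: K_def)
    then have K: "hermitian K"
      by (simp add: hermitian_def conj_transpose_def vec_eq_iff)
    have "K ** diag_mat ?w - diag_mat ?w ** K = diag_mat ?w ** (B - P)"
    proof -
      have "(K ** diag_mat ?w - diag_mat ?w ** K) $ i $ j = (diag_mat ?w ** (B - P)) $ i $ j" for i j
      proof -
        have "K $ i $ j * ?w j - ?w i * K $ i $ j = K $ i $ j * (?w j - ?w i)"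
          by (simp add: algebra_simps)
        also have "\<dots> = ?w i * (B - P) $ i $ j"
          by (simp add: K_def P_def pinch_def)
        finally show ?thesis by (simp add: diag_mult_left diag_mult_right)
      qed
      then show ?thesis by (simp add: vec_eq_iff)
    qed
    then have eq: "?c K ** hexp 1 Z - hexp 1 Z ** ?c K = hexp 1 Z ** (X - ?c P)"
      by (simp add: XB W cc cd)
    have comm: "udiag Q ?p ** ?c P = ?c P ** udiag Q ?p"
    proof -
      have "?p i * P $ i $ j = P $ i $ j * ?p j" for i j
        by (cases "?w i = ?w j") (simp_all add: P_def pinch_def parg_def)
      then have "diag_mat ?p ** P = P ** diag_mat ?p"
        by (simp add: vec_eq_iff diag_mult_left diag_mult_right)
      then show ?thesis by (simp add: udiag_def cc)
    qed
    have "\<phi> X = \<phi> B" by (simp add: XB unitary_conj Q)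
    then have "\<phi> (?c P) \<le> \<phi> X" and
      "strictly_convex_norm \<phi> \<longrightarrow> \<phi> (?c P) = \<phi> X \<longrightarrow> ?c P = X"
      using pinch[of ?w B] by (auto simp: unitary_conj Q P_def XB)
    with P K eq comm show "\<exists>P K. hermitian P \<and> hermitian K \<and> udiag Q ?p ** P = P ** udiag Q ?p \<and>
      K ** hexp 1 Z - hexp 1 Z ** K = hexp 1 Z ** (X - P) \<and> \<phi> P \<le> \<phi> X \<and>
      (strictly_convex_norm \<phi> \<longrightarrow> \<phi> P = \<phi> X \<longrightarrow> P = X)"
      by (intro exI[of _ "?c P"] exI[of _ "?c K"]) (simp add: hermitian_conj)
  qed
qed

section \<open>The lower bound for the length of a curve\<close>

text \<open>By \<open>diag_mono\<close> each eigenvalue alone is controlled, uniformly in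
  \<open>Q\<close>; a bound on \<phi> thus confines the angles to a ball.\<close>

lemma eigenvalue_bound: "\<exists>c\<ge>0. \<forall>Q\<in>unitary_group. \<forall>\<theta> :: real^'n. norm \<theta> \<le> c * \<phi> (udiag Q (\<lambda>j. complex_of_real (\<theta> $ j)))"
proof -
  define e where "e j = \<phi> (diag_mat (\<lambda>k. if k = j then 1 else 0))" for j :: 'n
  have e: "e j > 0" for j
  proof -
    have "diag_mat (\<lambda>k. if k = j then 1 else 0) \<noteq> 0"
      by (metis (mono_tags, lifting) diag_entry zero_index zero_neq_one)
    then show ?thesis
      unfolding e_def by (metis eq_0_iff nonneg order_less_le)
  qed
  have "norm \<theta> \<le> (\<Sum>j\<in>UNIV. 1 / e j) * \<phi> (udiag Q (\<lambda>j. complex_of_real (\<theta> $ j)))"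
    if "Q \<in> unitary_group" for Q and \<theta> :: "real^'n"
  proof -
    have "\<bar>\<theta> $ j\<bar> * e j \<le> \<phi> (diag_mat (\<lambda>j. complex_of_real (\<theta> $ j)))" for j
    proof -
      have "\<bar>\<theta> $ j\<bar> * e j = \<phi> (cscale (complex_of_real (\<theta> $ j)) (diag_mat (\<lambda>k. if k = j then 1 else 0)))"
        by (simp add: cscale e_def)
      also have "\<dots> \<le> \<phi> (diag_mat (\<lambda>j. complex_of_real (\<theta> $ j)))"
        unfolding diag_cscale by (rule diag_mono) simp
      finally show ?thesis .
    qed
    then have "\<bar>\<theta> $ j\<bar> \<le> 1 / e j * \<phi> (diag_mat (\<lambda>j. complex_of_real (\<theta> $ j)))" for j
      using e[of j] by (simp add: pos_le_divide_eq)
    then have "(\<Sum>j\<in>UNIV. \<bar>\<theta> $ j\<bar>) \<le> (\<Sum>j\<in>UNIV. 1 / e j * \<phi> (diag_mat (\<lambda>j. complex_of_real (\<theta> $ j))))"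
      by (intro sum_mono)
    with norm_le_l1_cart[of \<theta>] show ?thesis
      using that by (simp add: udiag sum_distrib_right)
  qed
  moreover have "(\<Sum>j\<in>UNIV. 1 / e j) \<ge> 0"
    using e by (simp add: sum_nonneg less_imp_le)
  ultimately show ?thesis by blast
qed

text \<open>The larger of the two excesses is continuous in the pair of eigenbasis and angles, so it
  attains its minimum on a compact set, and that minimum cannot be positive. In these coordinates
  the exponential is visibly continuous.\<close>

lemma log_limit:
  fixes V :: "'n cmatrix"
  assumes "\<And>\<epsilon>. \<epsilon> > 0 \<Longrightarrow> \<exists>Z. hermitian Z \<and> \<phi> Z \<le> B + \<epsilon> \<and> \<phi> (hexp 1 Z - V) \<le> b + \<epsilon>"
  shows "\<exists>Z. hermitian Z \<and> \<phi> Z \<le> B \<and> \<phi> (hexp 1 Z - V) \<le> b"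
proof -
  obtain c where c: "c \<ge> 0" and bound: "\<And>Q (\<theta> :: real^'n). Q \<in> unitary_group \<Longrightarrow>
      norm \<theta> \<le> c * \<phi> (udiag Q (\<lambda>j. complex_of_real (\<theta> $ j)))"
    using eigenvalue_bound by blast
  let ?Z = "\<lambda>x. udiag (fst x) (\<lambda>j. complex_of_real (snd x $ j))"
  let ?E = "\<lambda>x :: 'n cmatrix \<times> (real^'n). udiag (fst x) (\<lambda>j. cis (snd x $ j))"
  \<comment> \<open>The radius leaves room for an excess of 1, which is why \<epsilon> is capped at
    1 below.\<close>
  define S :: "('n cmatrix \<times> (real^'n)) set" where "S = unitary_group \<times> cball 0 (c * (B + 1))"
  define f where "f x = max (\<phi> (?Z x) - B) (\<phi> (?E x - V) - b)" for x
  have hexpE: "hexp 1 (?Z x) = ?E x" if "x \<in> S" for x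
    using that hexp_udiag[of "fst x" 1 "\<lambda>j. snd x $ j"] by (auto simp: S_def)
  have ex: "\<exists>x\<in>S. f x \<le> \<epsilon>" if "0 < \<epsilon>" "\<epsilon> \<le> 1" for \<epsilon>
  proof -
    from assms[OF that(1)] obtain Z where Z: "hermitian Z" "\<phi> Z \<le> B + \<epsilon>" "\<phi> (hexp 1 Z - V) \<le> b + \<epsilon>"
      by blast
    obtain Q \<theta> where Q: "Q \<in> unitary_group" "Z = udiag Q (\<lambda>j. complex_of_real (\<theta> j))"
      using hermitian_diagonalization[OF Z(1)] by blast
    let ?x = "(Q, \<chi> j. \<theta> j)"
    have Zx: "?Z ?x = Z" by (simp add: Q)
    have "norm (snd ?x) \<le> c * \<phi> Z" using bound[OF Q(1), of "snd ?x"] by (simp add: Q)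
    also have "\<dots> \<le> c * (B + 1)" using c Z(2) that by (intro mult_left_mono) auto
    finally have "?x \<in> S" by (simp add: S_def Q)
    moreover from this have "f ?x \<le> \<epsilon>"
      unfolding f_def hexpE[symmetric] Zx using Z hexpE[of ?x] Zx by simp
    ultimately show ?thesis by blast
  qed
  have "compact S"
    unfolding S_def by (intro compact_Times compact_unitary compact_cball)
  moreover have "S \<noteq> {}" using ex[of 1] by auto
  moreover have "continuous_on S f"
    unfolding f_def
    by (intro continuous_intros continuous_on_udiag continuous_on_compose2[OF continuous_on_cis]) auto
  ultimately obtain x where x: "x \<in> S" "\<And>y. y \<in> S \<Longrightarrow> f x \<le> f y"
    using continuous_attains_inf[of S f] by blast
  have "f x \<le> 0 + \<epsilon>" if "\<epsilon> > 0" for \<epsilon>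
  proof -
    have "0 < min \<epsilon> 1" "min \<epsilon> 1 \<le> 1" using that by auto
    from ex[OF this] obtain y where "y \<in> S" "f y \<le> min \<epsilon> 1" by blast
    then show ?thesis using x(2)[of y] by simp
  qed
  then have "f x \<le> 0" by (rule field_le_epsilon)
  then have "\<phi> (?Z x) \<le> B" "\<phi> (hexp 1 (?Z x) - V) \<le> b"
    using hexpE[OF x(1)] by (auto simp: f_def)
  then show ?thesis using hermitian_udiag by blast
qed


lemma has_vector_derivative_zeroD:
  assumes "(D has_vector_derivative 0) (at s within S)" "D s = 0" "\<epsilon> > 0"
  shows "\<exists>\<delta>>0. \<forall>t\<in>S. \<bar>t - s\<bar> < \<delta> \<longrightarrow> \<phi> (D t) \<le> \<epsilon> * \<bar>t - s\<bar>"
proof -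
  obtain C where C: "C > 0" "\<And>A. \<phi> A \<le> C * norm A" using norm_bound by blast
  have "\<epsilon> / C > 0" using assms(3) C(1) by simp
  then obtain \<delta> where \<delta>: "\<delta> > 0" "\<And>t. t \<in> S \<Longrightarrow> \<bar>t - s\<bar> < \<delta> \<Longrightarrow> norm (D t) \<le> \<epsilon> / C * \<bar>t - s\<bar>"
    using assms(1,2) unfolding has_vector_derivative_def has_derivative_within_alt by fastforce
  have "\<phi> (D t) \<le> \<epsilon> * \<bar>t - s\<bar>" if "t \<in> S" "\<bar>t - s\<bar> < \<delta>" for t
  proof -
    have "\<phi> (D t) \<le> C * norm (D t)" by (rule C)
    also have "\<dots> \<le> C * (\<epsilon> / C * \<bar>t - s\<bar>)" using \<delta>(2)[OF that] C(1) by (intro mult_left_mono) auto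
    finally show ?thesis using C(1) by simp
  qed
  then show ?thesis using \<delta>(1) by blast
qed

text \<open>Here \<open>Z\<close> is only an approximate logarithm of \<open>\<gamma> s\<close>, whose error is propagated.\<close>

lemma log_step:
  fixes \<gamma> :: "real \<Rightarrow> 'n cmatrix"
  assumes der: "(\<gamma> has_vector_derivative D) (at s within {p..q})" and s: "p \<le> s" "s < q"
    and U: "\<And>t. t \<in> {p..q} \<Longrightarrow> \<gamma> t \<in> unitary_group"
    and Z: "hermitian Z" and "\<epsilon> > 0"
  shows "\<exists>\<delta>>0. \<forall>t\<in>{s..q}. t - s < \<delta> \<longrightarrow> (\<exists>Z'. hermitian Z' \<and> \<phi> Z' \<le> \<phi> Z + (t - s) * \<phi> D \<and>
      \<phi> (hexp 1 Z' - \<gamma> t) \<le> \<phi> (hexp 1 Z - \<gamma> s) + \<epsilon> * (t - s))"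
proof -
  define W where "W = hexp 1 Z"
  define X where "X = cscale (- \<i>) (adj (\<gamma> s) ** D)"
  have sU: "\<gamma> s \<in> unitary_group" using U s by simp
  have W: "W \<in> unitary_group" unfolding W_def by (rule unitary_hexp[OF Z])
  have X: "hermitian X"
    unfolding X_def by (rule unitary_velocity[OF der]) (use s U in auto)
  have X_D: "cscale \<i> X = adj (\<gamma> s) ** D"
    by (simp add: X_def)
  have "\<phi> X = \<phi> D"
    by (simp add: X_def cscale unitary_left unitary_adj sU)
  obtain Z' where Z': "hermitian Z'" "hexp 1 Z' = W" "\<phi> Z' \<le> \<phi> Z"
    and step: "\<And>X. hermitian X \<Longrightarrow> \<exists>P K. hermitian P \<and> hermitian K \<and> Z' ** P = P ** Z' \<and>
      K ** W - W ** K = W ** (X - P) \<and> \<phi> P \<le> \<phi> X \<and>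
      (strictly_convex_norm \<phi> \<longrightarrow> \<phi> P = \<phi> X \<longrightarrow> P = X)"
    using principal_log[OF Z] unfolding W_def by blast
  from step[OF X] obtain P K where P: "hermitian P" and K: "hermitian K" and comm: "Z' ** P = P ** Z'"
    and KW: "K ** W - W ** K = W ** (X - P)" and PX: "\<phi> P \<le> \<phi> X"
    by blast
  \<comment> \<open>\<open>D1\<close> is exp (i (Z' + (t - s) P)) conjugated by exp (i (t - s) K),
    and \<open>D2\<close> is the curve translated to pass through \<open>W\<close> at time
    \<open>s\<close>. The commutator equation says exactly that their velocities at \<open>s\<close>
    agree.\<close>
  define D1 where "D1 t = hexp (t - s) K ** W ** hexp (t - s) P ** hexp (t - s) (- K)" for t
  define D2 where "D2 t = W ** adj (\<gamma> s) ** \<gamma> t" for t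
  have h0: "hexp (s - s) A = mat 1" if "hermitian A" for A :: "'n cmatrix"
    using hexp_zero[OF that] by simp
  have "((\<lambda>t. D1 t - D2 t) has_vector_derivative
      (hexp (s - s) K ** W ** hexp (s - s) P ** (cscale \<i> (- K) ** hexp (s - s) (- K)) +
       (hexp (s - s) K ** W ** (cscale \<i> P ** hexp (s - s) P) +
        (hexp (s - s) K ** 0 + cscale \<i> K ** hexp (s - s) K ** W) ** hexp (s - s) P) ** hexp (s - s) (- K))
      - (W ** adj (\<gamma> s) ** D + 0 ** \<gamma> s)) (at s within {p..q})"
    unfolding D1_def D2_def
    by (intro has_vector_derivative_diff has_vector_derivative_matrix_mult hexp_shift_has_vector_derivative
        has_vector_derivative_const hermitian_minus P K der)
  also have "(hexp (s - s) K ** W ** hexp (s - s) P ** (cscale \<i> (- K) ** hexp (s - s) (- K)) +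
       (hexp (s - s) K ** W ** (cscale \<i> P ** hexp (s - s) P) +
        (hexp (s - s) K ** 0 + cscale \<i> K ** hexp (s - s) K ** W) ** hexp (s - s) P) ** hexp (s - s) (- K))
      - (W ** adj (\<gamma> s) ** D + 0 ** \<gamma> s)
      = W ** cscale \<i> (- K) + W ** cscale \<i> P + cscale \<i> K ** W - W ** cscale \<i> X"
    by (simp only: h0 K P hermitian_minus X_D)
      (simp add: matrix_mul_assoc[symmetric] matrix_add_rdistrib)
  also have "\<dots> = cscale \<i> ((K ** W - W ** K) - W ** (X - P))"
    by (simp add: cscale_mult_left cscale_mult_right cscale_add cscale_diff matrix_diff_ldistrib)
      (simp add: cscale_def vec_eq_iff matrix_matrix_mult_def sum_negf algebra_simps)
  also have "\<dots> = 0" by (simp add: KW)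
  finally have "((\<lambda>t. D1 t - D2 t) has_vector_derivative 0) (at s within {p..q})" .
  moreover have "D1 s - D2 s = 0"
    using sU by (simp only: D1_def D2_def h0 K P hermitian_minus)
      (simp add: matrix_mul_assoc[symmetric] unitaryD)
  ultimately obtain \<delta> where \<delta>: "\<delta> > 0" "\<And>t. t \<in> {p..q} \<Longrightarrow> \<bar>t - s\<bar> < \<delta> \<Longrightarrow> \<phi> (D1 t - D2 t) \<le> \<epsilon> * \<bar>t - s\<bar>"
    using has_vector_derivative_zeroD[OF _ _ \<open>\<epsilon> > 0\<close>] by blast
  have "\<exists>Z'. hermitian Z' \<and> \<phi> Z' \<le> \<phi> Z + (t - s) * \<phi> D \<and>
      \<phi> (hexp 1 Z' - \<gamma> t) \<le> \<phi> (hexp 1 Z - \<gamma> s) + \<epsilon> * (t - s)" if t: "t \<in> {s..q}" "t - s < \<delta>" for t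
  proof -
    define V where "V = hexp (t - s) K"
    have V: "V \<in> unitary_group" unfolding V_def by (rule unitary_hexp[OF K])
    let ?Z = "V ** (Z' + (t - s) *\<^sub>R P) ** adj V"
    have herm: "hermitian (Z' + (t - s) *\<^sub>R P)"
      by (intro hermitian_add hermitian_scaleR Z' P)
    have "\<phi> ?Z \<le> \<phi> Z' + (t - s) * \<phi> P"
      using triangle[of Z' "(t - s) *\<^sub>R P"] t V by (simp add: unitary_conj scaleR)
    also have "\<dots> \<le> \<phi> Z + (t - s) * \<phi> D"
      using t PX \<open>\<phi> X = \<phi> D\<close> Z'(3) by (intro add_mono mult_left_mono) auto
    finally have 1: "\<phi> ?Z \<le> \<phi> Z + (t - s) * \<phi> D" .
    have "hexp 1 ?Z = D1 t"
    proof -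
      have "hexp 1 (Z' + (t - s) *\<^sub>R P) = W ** hexp (t - s) P"
        by (subst hexp_commuting_add)
          (simp_all add: Z' P hermitian_scaleR scaleR_mult_left scaleR_mult_right comm hexp_scaleR)
      then show ?thesis
        by (simp add: hexp_conj[OF herm V] D1_def) (simp add: V_def adj_hexp K hexp_minus matrix_mul_assoc)
    qed
    then have "\<phi> (hexp 1 ?Z - \<gamma> t) \<le> \<phi> (D1 t - D2 t) + \<phi> (D2 t - \<gamma> t)"
      by (simp add: diff_triangle)
    \<comment> \<open>The old error is multiplied by a unitary matrix, so it is carried along
      without growing.\<close>
    also have "D2 t - \<gamma> t = (W - \<gamma> s) ** (adj (\<gamma> s) ** \<gamma> t)"
      using sU by (simp add: D2_def matrix_diff_rdistrib unitary_cancel matrix_mul_assoc[symmetric])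
    also have "\<phi> \<dots> = \<phi> (W - \<gamma> s)"
      using U s t sU by (intro unitary_right unitary_mult unitary_adj) auto
    also have "\<phi> (D1 t - D2 t) \<le> \<epsilon> * (t - s)"
      using \<delta>(2)[of t] s t by auto
    finally have "\<phi> (hexp 1 ?Z - \<gamma> t) \<le> \<phi> (hexp 1 Z - \<gamma> s) + \<epsilon> * (t - s)"
      by (simp add: W_def)
    with 1 show ?thesis using hermitian_conj[OF herm] by blast
  qed
  then show ?thesis using \<delta>(1) by blast
qed

text \<open>A supremum argument: the good times contain their supremum by \<open>log_limit\<close>,
  and \<open>log_step\<close> would carry them beyond it before \<open>q\<close>.\<close>

lemma log_along_C1_curve:
  fixes \<gamma> \<gamma>' :: "real \<Rightarrow> 'n cmatrix"
  assumes pq: "p \<le> q" and cont: "continuous_on {p..q} \<gamma>'"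
    and der: "\<And>t. t \<in> {p..q} \<Longrightarrow> (\<gamma> has_vector_derivative \<gamma>' t) (at t within {p..q})"
    and U: "\<And>t. t \<in> {p..q} \<Longrightarrow> \<gamma> t \<in> unitary_group"
    and Z0: "hermitian Z0" "hexp 1 Z0 = \<gamma> p"
  shows "\<exists>Z. hermitian Z \<and> \<phi> Z \<le> \<phi> Z0 + integral {p..q} (\<lambda>t. \<phi> (\<gamma>' t)) \<and> hexp 1 Z = \<gamma> q"
proof -
  define F where "F s = integral {p..s} (\<lambda>t. \<phi> (\<gamma>' t))" for s
  have contphi: "continuous_on {p..q} (\<lambda>t. \<phi> (\<gamma>' t))" by (intro continuous_intros cont)
  have int: "(\<lambda>t. \<phi> (\<gamma>' t)) integrable_on {c..d}" if "p \<le> c" "d \<le> q" for c d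
    using that by (intro integrable_continuous_real continuous_on_subset[OF contphi]) auto
  have F_add: "F d = F c + integral {c..d} (\<lambda>t. \<phi> (\<gamma>' t))" if "p \<le> c" "c \<le> d" "d \<le> q" for c d
    unfolding F_def using that by (intro Henstock_Kurzweil_Integration.integral_combine[symmetric] int) auto
  have F_mono: "F c \<le> F d" if "p \<le> c" "c \<le> d" "d \<le> q" for c d
    using F_add[OF that] that by (simp add: integral_nonneg int nonneg)
  have cont\<gamma>: "continuous_on {p..q} \<gamma>"
    unfolding continuous_on_eq_continuous_within using der has_vector_derivative_continuous by blast
  have main: "\<exists>Z. hermitian Z \<and> \<phi> Z \<le> \<phi> Z0 + F q + \<epsilon> * (q - p) \<and> \<phi> (hexp 1 Z - \<gamma> q) \<le> \<epsilon> * (q - p)"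
    if \<epsilon>: "\<epsilon> > 0" for \<epsilon>
  proof -
    \<comment> \<open>Each bound gains \<epsilon> per unit of time. In the norm this pays for
      freezing the speed at the start of a step, in the distance for the first order error of
      \<open>log_step\<close>.\<close>
    define A where "A = {s \<in> {p..q}. \<exists>Z. hermitian Z \<and> \<phi> Z \<le> \<phi> Z0 + F s + \<epsilon> * (s - p) \<and>
      \<phi> (hexp 1 Z - \<gamma> s) \<le> \<epsilon> * (s - p)}"
    have "p \<in> A" using pq Z0 by (auto simp: A_def F_def)
    have bdd: "bdd_above A" by (rule bdd_aboveI[of _ q]) (simp add: A_def)
    define s where "s = Sup A"
    have "p \<le> s" unfolding s_def by (rule cSup_upper[OF \<open>p \<in> A\<close> bdd])
    moreover have "s \<le> q"
    proof -
      have "A \<noteq> {}" using \<open>p \<in> A\<close> by blast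
      moreover have "t \<le> q" if "t \<in> A" for t using that by (simp add: A_def)
      ultimately show ?thesis unfolding s_def by (rule cSup_least)
    qed
    ultimately have s: "p \<le> s" "s \<le> q" .
    \<comment> \<open>A logarithm from a good time just before \<open>s\<close> serves; \<eta>
      absorbs the distance between the two points of the curve.\<close>
    have "\<exists>Z. hermitian Z \<and> \<phi> Z \<le> \<phi> Z0 + F s + \<epsilon> * (s - p) + \<eta> \<and> \<phi> (hexp 1 Z - \<gamma> s) \<le> \<epsilon> * (s - p) + \<eta>"
      if "\<eta> > 0" for \<eta>
    proof -
      have "continuous_on {p..q} (\<lambda>t. \<phi> (\<gamma> t - \<gamma> s))" by (intro continuous_intros cont\<gamma>)
      then obtain d where d: "d > 0" "\<And>t. t \<in> {p..q} \<Longrightarrow> \<bar>t - s\<bar> < d \<Longrightarrow> \<phi> (\<gamma> t - \<gamma> s) < \<eta>"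
        using s \<open>\<eta> > 0\<close> unfolding continuous_on_iff by (force simp: dist_real_def nonneg)
      have "s - d < Sup A" using d by (simp add: s_def)
      then obtain t where t: "t \<in> A" "s - d < t"
        using \<open>p \<in> A\<close> less_cSupE by blast
      have "t \<le> s" unfolding s_def by (rule cSup_upper[OF t(1) bdd])
      from t obtain Z where Z: "hermitian Z" "\<phi> Z \<le> \<phi> Z0 + F t + \<epsilon> * (t - p)" "\<phi> (hexp 1 Z - \<gamma> t) \<le> \<epsilon> * (t - p)"
        and tpq: "t \<in> {p..q}"
        by (auto simp: A_def)
      have "\<epsilon> * (t - p) \<le> \<epsilon> * (s - p)" using \<epsilon> \<open>t \<le> s\<close> by simp
      moreover have "F t \<le> F s" using F_mono[of t s] tpq \<open>t \<le> s\<close> s by auto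
      moreover have "\<phi> (\<gamma> t - \<gamma> s) < \<eta>" using d(2)[OF tpq] t(2) \<open>t \<le> s\<close> by auto
      ultimately show ?thesis
        using Z diff_triangle[of "hexp 1 Z" "\<gamma> s" "\<gamma> t"] \<open>\<eta> > 0\<close> by (intro exI[of _ Z]) linarith
    qed
    then obtain Z where Z: "hermitian Z" "\<phi> Z \<le> \<phi> Z0 + F s + \<epsilon> * (s - p)" "\<phi> (hexp 1 Z - \<gamma> s) \<le> \<epsilon> * (s - p)"
      using log_limit[of "\<phi> Z0 + F s + \<epsilon> * (s - p)" "\<gamma> s" "\<epsilon> * (s - p)"] by blast
    have "s = q"
    proof (rule ccontr)
      assume "s \<noteq> q"
      then have sq: "s < q" using s by simp
      then have spq: "s \<in> {p..q}" using s by simp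
      obtain d1 where d1: "d1 > 0" "\<And>t. t \<in> {s..q} \<Longrightarrow> t - s < d1 \<Longrightarrow>
          (\<exists>Z'. hermitian Z' \<and> \<phi> Z' \<le> \<phi> Z + (t - s) * \<phi> (\<gamma>' s) \<and>
           \<phi> (hexp 1 Z' - \<gamma> t) \<le> \<phi> (hexp 1 Z - \<gamma> s) + \<epsilon> * (t - s))"
        using log_step[OF der[OF spq] s(1) sq U Z(1) \<epsilon>] by blast
      obtain d2 where d2: "d2 > 0" "\<And>t. t \<in> {p..q} \<Longrightarrow> \<bar>t - s\<bar> < d2 \<Longrightarrow> \<bar>\<phi> (\<gamma>' t) - \<phi> (\<gamma>' s)\<bar> < \<epsilon>"
        using contphi spq \<epsilon> unfolding continuous_on_iff dist_real_def by blast
      define t where "t = s + min (min d1 d2) (q - s) / 2"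
      have t: "s < t" "t \<le> q" "t - s < d1" "t - s < d2"
        using d1(1) d2(1) sq by (auto simp: t_def min_def field_simps)
      from d1(2)[of t] t obtain Z' where Z': "hermitian Z'" "\<phi> Z' \<le> \<phi> Z + (t - s) * \<phi> (\<gamma>' s)"
          "\<phi> (hexp 1 Z' - \<gamma> t) \<le> \<phi> (hexp 1 Z - \<gamma> s) + \<epsilon> * (t - s)"
        by auto
      \<comment> \<open>Near \<open>s\<close> the speed stays above its value at \<open>s\<close>
        minus \<epsilon>, so the cost of the step is covered by the integral and the allowed
        slack.\<close>
      have "integral {s..t} (\<lambda>_. \<phi> (\<gamma>' s) - \<epsilon>) \<le> integral {s..t} (\<lambda>t. \<phi> (\<gamma>' t))"
      proof (rule integral_le)
        fix u assume "u \<in> {s..t}"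
        then show "\<phi> (\<gamma>' s) - \<epsilon> \<le> \<phi> (\<gamma>' u)"
          using d2(2)[of u] t s by auto
      qed (use s t in \<open>auto intro: int\<close>)
      then have "(t - s) * \<phi> (\<gamma>' s) \<le> integral {s..t} (\<lambda>t. \<phi> (\<gamma>' t)) + \<epsilon> * (t - s)"
        using t by (simp add: algebra_simps)
      with F_add[of s t] s t Z'(2) Z(2) have "\<phi> Z' \<le> \<phi> Z0 + F t + \<epsilon> * (t - p)"
        by (simp add: algebra_simps)
      moreover have "\<phi> (hexp 1 Z' - \<gamma> t) \<le> \<epsilon> * (t - p)"
        using Z'(3) Z(3) by (simp add: algebra_simps)
      ultimately have "t \<in> A" using Z'(1) s t by (auto simp: A_def)
      then have "t \<le> s" unfolding s_def using bdd by (rule cSup_upper)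
      with t show False by simp
    qed
    with Z show ?thesis by blast
  qed
  have "\<exists>Z. hermitian Z \<and> \<phi> Z \<le> \<phi> Z0 + F q \<and> \<phi> (hexp 1 Z - \<gamma> q) \<le> 0"
  proof (rule log_limit)
    fix \<epsilon> :: real assume "\<epsilon> > 0"
    \<comment> \<open>The added 1 keeps the quotient meaningful for \<open>p = q\<close>.\<close>
    define \<epsilon>' where "\<epsilon>' = \<epsilon> / (q - p + 1)"
    have "\<epsilon>' > 0" using \<open>\<epsilon> > 0\<close> pq by (simp add: \<epsilon>'_def)
    moreover have "\<epsilon>' * (q - p) \<le> \<epsilon>"
      using \<open>\<epsilon> > 0\<close> pq by (simp add: \<epsilon>'_def field_simps)
    ultimately show "\<exists>Z. hermitian Z \<and> \<phi> Z \<le> \<phi> Z0 + F q + \<epsilon> \<and> \<phi> (hexp 1 Z - \<gamma> q) \<le> 0 + \<epsilon>"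
      using main[of \<epsilon>'] by fastforce
  qed
  then show ?thesis
    using nonneg by (metis F_def eq_0_iff eq_iff_diff_eq_0 order_antisym)
qed

end

lemma hexp_of_zero [simp]: "hexp t 0 = mat 1"
proof -
  have "hermitian (0 :: 'a cmatrix)" by (simp add: hermitian_def conj_transpose_def vec_eq_iff)
  from hexp_zero[OF this] show ?thesis using hexp_scaleR[of t 0 "0 :: 'a cmatrix"] by simp
qed

lemma hermitian_zero: "hermitian 0"
  by (simp add: hermitian_def conj_transpose_def vec_eq_iff)

lemma continuous_on_hexp: "hermitian Z \<Longrightarrow> continuous_on S (\<lambda>t. hexp t Z)"
  unfolding continuous_on_eq_continuous_within
  using hexp_has_vector_derivative has_vector_derivative_continuous by blast

context ui_norm
begin

text \<open>Left translation by \<open>adj U0\<close> preserves \<phi>. The free initial logarithm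
  \<open>Z0\<close> is what allows pieces to be chained.\<close>

lemma log_increment_C1_curve:
  fixes \<gamma> \<gamma>' :: "real \<Rightarrow> 'n cmatrix"
  assumes pq: "p \<le> q" and cont: "continuous_on {p..q} \<gamma>'"
    and der: "\<And>t. t \<in> {p..q} \<Longrightarrow> (\<gamma> has_vector_derivative \<gamma>' t) (at t within {p..q})"
    and U: "\<And>t. t \<in> {p..q} \<Longrightarrow> \<gamma> t \<in> unitary_group"
    and U0: "U0 \<in> unitary_group" and Z0: "hermitian Z0" "\<gamma> p = U0 ** hexp 1 Z0"
  shows "\<exists>Z. hermitian Z \<and> \<phi> Z \<le> \<phi> Z0 + integral {p..q} (\<lambda>t. \<phi> (\<gamma>' t)) \<and> \<gamma> q = U0 ** hexp 1 Z"
proof -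
  have "\<exists>Z. hermitian Z \<and> \<phi> Z \<le> \<phi> Z0 + integral {p..q} (\<lambda>t. \<phi> (adj U0 ** \<gamma>' t)) \<and> hexp 1 Z = adj U0 ** \<gamma> q"
  proof (rule log_along_C1_curve[OF pq _ _ _ Z0(1)])
    show "continuous_on {p..q} (\<lambda>t. adj U0 ** \<gamma>' t)"
      by (intro continuous_intros cont)
    show "hexp 1 Z0 = adj U0 ** \<gamma> p" by (simp add: Z0 U0 unitary_cancel)
    fix t assume t: "t \<in> {p..q}"
    show "adj U0 ** \<gamma> t \<in> unitary_group" using U[OF t] U0 by (simp add: unitary_mult unitary_adj)
    show "((\<lambda>t. adj U0 ** \<gamma> t) has_vector_derivative adj U0 ** \<gamma>' t) (at t within {p..q})"
      using has_vector_derivative_matrix_mult[OF has_vector_derivative_const der[OF t]] by simp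
  qed
  then show ?thesis
    by (metis (no_types, lifting) U0 integral_cong unitary_adj unitary_cancel(2) unitary_left)
qed

lemma log_along_curve:
  fixes \<gamma> :: "real \<Rightarrow> 'n cmatrix"
  assumes pw: "piecewise_smooth_curve \<gamma> a b" and U: "\<gamma> ` {a..b} \<subseteq> unitary_group"
  defines "g \<equiv> \<lambda>t. \<phi> (vector_derivative \<gamma> (at t within {a..b}))"
  shows "g integrable_on {a..b}"
    and "a \<le> s \<Longrightarrow> s \<le> t \<Longrightarrow> t \<le> b \<Longrightarrow>
      \<exists>X. hermitian X \<and> \<phi> X \<le> integral {s..t} g \<and> \<gamma> t = \<gamma> s ** hexp 1 X"
proof -
  obtain m and p :: "nat \<Rightarrow> real" where p0: "p 0 = a" and pm: "p m = b"
    and p: "\<And>i. i < m \<Longrightarrow> p i < p (Suc i)" and C1: "\<And>i. i < m \<Longrightarrow> C1_on_interval \<gamma> (p i) (p (Suc i))"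
    using pw unfolding piecewise_smooth_curve_def by metis
  have p_mono: "p i \<le> p j" if "i \<le> j" "j \<le> m" for i j
    using that
  proof (induction j)
    case (Suc j)
    then show ?case using p[of j] by (cases "i = Suc j") auto
  qed simp
  have p_in: "a \<le> p i" "p i \<le> b" if "i \<le> m" for i
    using p_mono[of 0 i] p_mono[of i m] that p0 pm by auto
  have piece: "g integrable_on {c..d} \<and> (\<exists>Z. hermitian Z \<and> \<phi> Z \<le> \<phi> Z0 + integral {c..d} g \<and> \<gamma> d = U0 ** hexp 1 Z)"
    if i: "i < m" and cd: "p i \<le> c" "c \<le> d" "d \<le> p (Suc i)" and U0: "U0 \<in> unitary_group"
      and Z0: "hermitian Z0" "\<gamma> c = U0 ** hexp 1 Z0" for i c d U0 Z0
  proof -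
    from C1[OF i] obtain \<gamma>' where cont: "continuous_on {p i..p (Suc i)} \<gamma>'"
      and der: "\<And>t. t \<in> {p i..p (Suc i)} \<Longrightarrow> (\<gamma> has_vector_derivative \<gamma>' t) (at t within {p i..p (Suc i)})"
      unfolding C1_on_interval_def by blast
    have sub: "{c..d} \<subseteq> {p i..p (Suc i)}" using cd by auto
    have ab: "{p i..p (Suc i)} \<subseteq> {a..b}"
      using p_in[of i] p_in[of "Suc i"] i by auto
    have cont': "continuous_on {c..d} \<gamma>'" by (rule continuous_on_subset[OF cont sub])
    have der': "(\<gamma> has_vector_derivative \<gamma>' t) (at t within {c..d})" if "t \<in> {c..d}" for t
      using der sub that by (intro has_vector_derivative_within_subset[OF _ sub]) auto
    \<comment> \<open>Off the breakpoints the derivative within \<open>{a..b}\<close> is two-sided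
      and agrees with that of the piece; two points do not affect the integral.\<close>
    have g: "g t = \<phi> (\<gamma>' t)" if t: "t \<in> {c..d} - {p i, p (Suc i)}" for t
    proof -
      have t': "p i < t" "t < p (Suc i)" using t cd by auto
      then have "a < t" "t < b" using p_in[of i] p_in[of "Suc i"] i by auto
      then have "at t within {a..b} = at t" by (rule at_within_Icc_at)
      moreover have "(\<gamma> has_vector_derivative \<gamma>' t) (at t)"
        using der[of t] t' at_within_Icc_at[OF t'] by simp
      ultimately show ?thesis unfolding g_def by (simp add: vector_derivative_at)
    qed
    have "((\<lambda>t. \<phi> (\<gamma>' t)) has_integral integral {c..d} (\<lambda>t. \<phi> (\<gamma>' t))) {c..d}"
      by (intro integrable_integral integrable_continuous_real continuous_intros cont')
    then have "(g has_integral integral {c..d} (\<lambda>t. \<phi> (\<gamma>' t))) {c..d}"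
      by (rule has_integral_spike_finite[where S="{p i, p (Suc i)}", rotated 2]) (use g in auto)
    then have "g integrable_on {c..d}" "integral {c..d} g = integral {c..d} (\<lambda>t. \<phi> (\<gamma>' t))"
      by (auto simp: integral_unique)
    moreover have "\<exists>Z. hermitian Z \<and> \<phi> Z \<le> \<phi> Z0 + integral {c..d} (\<lambda>t. \<phi> (\<gamma>' t)) \<and> \<gamma> d = U0 ** hexp 1 Z"
      by (rule log_increment_C1_curve[OF cd(2) cont' der' _ U0 Z0]) (use U sub ab in auto)
    ultimately show ?thesis by simp
  qed
  have trivial: "\<exists>X. hermitian X \<and> \<phi> X \<le> integral {s..s} g \<and> \<gamma> s = \<gamma> s ** hexp 1 X" for s
    by (rule exI[of _ 0]) (simp add: hermitian_zero)
  have main: "g integrable_on {a..p i} \<and> (\<forall>s t. a \<le> s \<longrightarrow> s \<le> t \<longrightarrow> t \<le> p i \<longrightarrow>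
      (\<exists>X. hermitian X \<and> \<phi> X \<le> integral {s..t} g \<and> \<gamma> t = \<gamma> s ** hexp 1 X))" if "i \<le> m" for i
    using that
  proof (induction i)
    case 0
    have "\<exists>X. hermitian X \<and> \<phi> X \<le> integral {s..t} g \<and> \<gamma> t = \<gamma> s ** hexp 1 X"
      if "a \<le> s" "s \<le> t" "t \<le> p 0" for s t
    proof -
      have "s = a" "t = a" using that by (auto simp: p0)
      then show ?thesis using trivial[of a] by simp
    qed
    then show ?case using integrable_on_refl[of g a] by (auto simp: p0)
  next
    case (Suc i)
    then have i: "i < m" and IH: "g integrable_on {a..p i}"
      "\<And>s t. a \<le> s \<Longrightarrow> s \<le> t \<Longrightarrow> t \<le> p i \<Longrightarrow> \<exists>X. hermitian X \<and> \<phi> X \<le> integral {s..t} g \<and> \<gamma> t = \<gamma> s ** hexp 1 X"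
      by auto
    have unit: "\<gamma> s \<in> unitary_group" if "a \<le> s" "s \<le> p (Suc i)" for s
      using that p_in[of "Suc i"] Suc.prems U by auto
    have le: "a \<le> p i" "p i \<le> p (Suc i)" using p_in[of i] p[OF i] i by auto
    have "g integrable_on {p i..p (Suc i)}"
      using piece[OF i order_refl le(2) order_refl unit[OF le] hermitian_zero] by simp
    then have int: "g integrable_on {a..p (Suc i)}"
      by (rule Henstock_Kurzweil_Integration.integrable_combine[OF le IH(1)])
    have "\<exists>X. hermitian X \<and> \<phi> X \<le> integral {s..t} g \<and> \<gamma> t = \<gamma> s ** hexp 1 X"
      if st: "a \<le> s" "s \<le> t" "t \<le> p (Suc i)" for s t
    proof (cases "t \<le> p i")
      case True
      then show ?thesis using IH(2) st by blast
    next
      case False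
      \<comment> \<open>Up to \<open>c\<close> the induction hypothesis applies, or nothing happens
        if \<open>s\<close> is already in the last piece; from \<open>c\<close> on, only that piece
        is involved.\<close>
      define c where "c = max s (p i)"
      have c: "s \<le> c" "c \<le> t" "p i \<le> c" using st False by (auto simp: c_def)
      have "\<exists>X. hermitian X \<and> \<phi> X \<le> integral {s..c} g \<and> \<gamma> c = \<gamma> s ** hexp 1 X"
      proof (cases "s \<le> p i")
        case True
        then show ?thesis using IH(2)[OF st(1) True order_refl] by (simp add: c_def)
      next
        case False
        then show ?thesis using trivial[of s] by (simp add: c_def)
      qed
      then obtain X0 where X0: "hermitian X0" "\<phi> X0 \<le> integral {s..c} g" "\<gamma> c = \<gamma> s ** hexp 1 X0"
        by blast
      have "\<gamma> s \<in> unitary_group" using st by (intro unit) auto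
      from piece[OF i c(3,2) st(3) this X0(1,3)] obtain X where
        X: "hermitian X" "\<phi> X \<le> \<phi> X0 + integral {c..t} g" "\<gamma> t = \<gamma> s ** hexp 1 X"
        by blast
      have "integral {s..c} g + integral {c..t} g = integral {s..t} g"
        using st c by (intro Henstock_Kurzweil_Integration.integral_combine integrable_on_subinterval[OF int]) auto
      with X X0(2) show ?thesis by (intro exI[of _ X]) auto
    qed
    with int show ?case by blast
  qed
  from main[of m] show "g integrable_on {a..b}" by (simp add: pm)
  from main[of m] show "a \<le> s \<Longrightarrow> s \<le> t \<Longrightarrow> t \<le> b \<Longrightarrow>
      \<exists>X. hermitian X \<and> \<phi> X \<le> integral {s..t} g \<and> \<gamma> t = \<gamma> s ** hexp 1 X"
    by (simp add: pm)
qed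

section \<open>Rigidity\<close>

text \<open>A triangle inequality for exponentials: the logarithm \<open>X\<close> is continued
  along exp (i X) exp (i t Y), whose speed is constantly \<phi> Y.\<close>

lemma log_product:
  assumes X: "hermitian X" and Y: "hermitian Y"
  shows "\<exists>Z. hermitian Z \<and> \<phi> Z \<le> \<phi> X + \<phi> Y \<and> hexp 1 Z = hexp 1 X ** hexp 1 Y"
proof -
  have "\<exists>Z. hermitian Z \<and> \<phi> Z \<le> \<phi> X + integral {0..1} (\<lambda>t. \<phi> (hexp 1 X ** (cscale \<i> Y ** hexp t Y)))
    \<and> hexp 1 Z = hexp 1 X ** hexp 1 Y"
  proof (rule log_along_C1_curve[where p=0 and q=1 and \<gamma>="\<lambda>t. hexp 1 X ** hexp t Y"
        and \<gamma>'="\<lambda>t. hexp 1 X ** (cscale \<i> Y ** hexp t Y)"])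
    show "continuous_on {0..1} (\<lambda>t. hexp 1 X ** (cscale \<i> Y ** hexp t Y))"
      by (intro continuous_intros continuous_on_hexp Y)
    show "((\<lambda>t. hexp 1 X ** hexp t Y) has_vector_derivative hexp 1 X ** (cscale \<i> Y ** hexp t Y)) (at t within {0..1})" for t
      using has_vector_derivative_matrix_mult[OF has_vector_derivative_const hexp_has_vector_derivative[OF Y]] by simp
  qed (simp_all add: hexp_zero Y X unitary_mult unitary_hexp)
  moreover have "\<phi> (hexp 1 X ** (cscale \<i> Y ** hexp t Y)) = \<phi> Y" for t
    by (simp add: unitary_left unitary_right unitary_hexp X Y cscale)
  ultimately show ?thesis by simp
qed

text \<open>Corner rounding: if \<open>P\<close> is the part of \<open>Y\<close> commuting with \<open>exp (i X)\<close>, then cutting the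
  corner at \<open>exp (i X)\<close> shows that the broken path from the identity through \<open>exp (i X)\<close> to
  \<open>exp (i X) exp (i Y)\<close> can only be shortest if \<open>\<phi> (X + P) = \<phi> X + \<phi> Y\<close>.\<close>

lemma triangle_equality:
  fixes X Y :: "'n cmatrix"
  assumes strict: "strictly_convex_norm \<phi>" and X: "hermitian X" and Y: "hermitian Y"
    and min: "\<And>M. hermitian M \<Longrightarrow> hexp 1 M = hexp 1 X ** hexp 1 Y \<Longrightarrow> \<phi> X + \<phi> Y \<le> \<phi> M"
  shows "\<exists>X'. hermitian X' \<and> hexp 1 X' = hexp 1 X \<and> \<phi> X' = \<phi> X \<and> \<phi> (X' + Y) = \<phi> X' + \<phi> Y"
proof -
  define W where "W = hexp 1 X"
  have W: "W \<in> unitary_group" unfolding W_def by (rule unitary_hexp[OF X])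
  obtain X' where X': "hermitian X'" "hexp 1 X' = W" "\<phi> X' \<le> \<phi> X"
    and step: "\<exists>P K. hermitian P \<and> hermitian K \<and> X' ** P = P ** X' \<and>
      K ** W - W ** K = W ** (Y - P) \<and> \<phi> P \<le> \<phi> Y \<and>
      (strictly_convex_norm \<phi> \<longrightarrow> \<phi> P = \<phi> Y \<longrightarrow> P = Y)"
    using principal_log[OF X] Y unfolding W_def by metis
  obtain P K where P: "hermitian P" and K: "hermitian K" and comm: "X' ** P = P ** X'"
    and KW: "K ** W - W ** K = W ** (Y - P)" and PY: "\<phi> P \<le> \<phi> Y"
    and eqD: "\<phi> P = \<phi> Y \<Longrightarrow> P = Y"
    using step strict by blast
  note herm = P K Y hermitian_minus[OF P] hermitian_minus[OF K]
  note der = has_vector_derivative_matrix_mult has_vector_derivative_const hexp_has_vector_derivative herm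
  \<comment> \<open>The factor \<open>E\<close> corrects the shortcut: exp (i (X' + t P)) followed
    by \<open>E t\<close> is \<open>W ** hexp t Y\<close> conjugated by exp (- i t K). Its velocity
    at 0 vanishes by the commutator equation, so its length up to \<open>h\<close> is o(h).\<close>
  define E1 where "E1 t = hexp t (- P) ** adj W ** hexp t (- K) ** W" for t
  define E where "E t = E1 t ** hexp t Y ** hexp t K" for t
  define D1 where "D1 t = (hexp t (- P) ** adj W ** (cscale \<i> (- K) ** hexp t (- K)) +
     (hexp t (- P) ** 0 + cscale \<i> (- P) ** hexp t (- P) ** adj W) ** hexp t (- K)) ** W" for t
  define D where "D t = E1 t ** hexp t Y ** (cscale \<i> K ** hexp t K) +
     (E1 t ** (cscale \<i> Y ** hexp t Y) + D1 t ** hexp t Y) ** hexp t K" for t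
  have E1: "(E1 has_vector_derivative D1 t) (at t within S)" for t S
  proof -
    have "((\<lambda>t. hexp t (- P) ** adj W ** hexp t (- K) ** W) has_vector_derivative
      hexp t (- P) ** adj W ** hexp t (- K) ** 0 + D1 t) (at t within S)"
      unfolding D1_def by (intro der)
    then show ?thesis by (simp add: E1_def[abs_def])
  qed
  have E: "(E has_vector_derivative D t) (at t within S)" for t S
    unfolding E_def[abs_def] D_def by (intro der E1)
  have contD: "continuous_on S D" for S
    unfolding D_def D1_def E1_def by (intro continuous_intros continuous_on_hexp herm)
  have EU: "E t \<in> unitary_group" for t
    unfolding E_def E1_def by (intro unitary_mult unitary_hexp unitary_adj W herm)
  have E0: "E 0 = mat 1"
    using W by (simp add: E_def E1_def hexp_zero herm unitaryD)
  have "D 0 = cscale \<i> K + (cscale \<i> Y + (adj W ** cscale \<i> (- K) + cscale \<i> (- P) ** adj W) ** W)"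
    using W by (simp add: D_def D1_def E1_def hexp_zero herm unitaryD)
  also have "\<dots> = cscale \<i> ((Y - P) - adj W ** (K ** W - W ** K))"
  proof -
    have neg: "cscale \<i> (- A) = - cscale \<i> A" for A :: "'n cmatrix"
      by (simp add: cscale_def vec_eq_iff)
    have "(adj W ** - cscale \<i> K + - cscale \<i> P ** adj W) ** W = - cscale \<i> (adj W ** (K ** W)) - cscale \<i> P"
      using matrix_diff_ldistrib[of "adj W" 0 "cscale \<i> K"] matrix_diff_rdistrib[of 0 "cscale \<i> P" "adj W"] W
        matrix_diff_rdistrib[of 0 "adj W ** cscale \<i> K" W] matrix_diff_rdistrib[of 0 "cscale \<i> P ** adj W" W]
      by (simp add: matrix_diff_rdistrib cscale_mult_left cscale_mult_right)
        (simp add: matrix_mul_assoc[symmetric] unitaryD)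
    then show ?thesis
      using W by (simp add: neg matrix_diff_ldistrib cscale_diff unitary_cancel)
  qed
  also have "\<dots> = 0" using W by (simp add: KW unitary_cancel)
  finally have D0: "D 0 = 0" .
  have "\<phi> X + \<phi> Y \<le> \<phi> (X' + P) + \<epsilon>" if \<epsilon>: "\<epsilon> > 0" for \<epsilon>
  proof -
    have "continuous_on UNIV (\<lambda>t. \<phi> (D t))" by (intro continuous_intros contD)
    then obtain d where d: "d > 0" "\<And>t. \<bar>t\<bar> < d \<Longrightarrow> \<phi> (D t) < \<epsilon>"
      using \<epsilon> D0 unfolding continuous_on_iff dist_real_def
      by (metis UNIV_I abs_of_nonneg diff_zero nonneg zero)
    define h where "h = min (d / 2) 1"
    have h: "0 < h" "h \<le> 1" "h < d" using d(1) by (auto simp: h_def)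
    obtain M0 where M0: "hermitian M0" "\<phi> M0 \<le> \<phi> 0 + integral {0..h} (\<lambda>t. \<phi> (D t))" "hexp 1 M0 = E h"
      using log_along_C1_curve[of 0 h D E 0] h contD E EU E0 hermitian_zero by auto
    have "integral {0..h} (\<lambda>t. \<phi> (D t)) \<le> integral {0..h} (\<lambda>_. \<epsilon>)"
    proof (rule integral_le)
      show "(\<lambda>t. \<phi> (D t)) integrable_on {0..h}"
        by (intro integrable_continuous_real continuous_intros contD)
      fix t assume "t \<in> {0..h}"
      then show "\<phi> (D t) \<le> \<epsilon>" using d(2)[of t] h by auto
    qed (rule integrable_const_ivl)
    then have M0_le: "\<phi> M0 \<le> h * \<epsilon>" using M0(2) h by simp
    have XP: "hermitian (X' + h *\<^sub>R P)" by (intro hermitian_add hermitian_scaleR X' P)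
    obtain M1 where M1: "hermitian M1" "\<phi> M1 \<le> \<phi> (X' + h *\<^sub>R P) + \<phi> M0" "hexp 1 M1 = hexp 1 (X' + h *\<^sub>R P) ** E h"
      using log_product[OF XP M0(1)] M0(3) by auto
    have "hexp 1 (X' + h *\<^sub>R P) = W ** hexp h P"
      by (subst hexp_commuting_add)
        (simp_all add: X' P hermitian_scaleR scaleR_mult_left scaleR_mult_right comm hexp_scaleR)
    then have "hexp 1 M1 = W ** (hexp h P ** (hexp h (- P) ** (adj W ** (hexp h (- K) ** (W ** (hexp h Y ** hexp h K))))))"
      by (simp add: M1(3) E_def E1_def matrix_mul_assoc)
    also have "\<dots> = adj (hexp h K) ** W ** hexp h Y ** hexp h K"
    proof -
      have "hexp h P ** (hexp h (- P) ** A) = A" for A :: "'n cmatrix"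
        using unitary_cancel(2)[OF unitary_hexp[OF P], of h A] by (simp add: hexp_minus adj_hexp P)
      then show ?thesis
        by (simp add: unitary_cancel W adj_hexp K hexp_minus matrix_mul_assoc[symmetric])
    qed
    finally have M1_eq: "hexp 1 M1 = adj (hexp h K) ** W ** hexp h Y ** hexp h K" .
    let ?V = "hexp h K"
    have V: "?V \<in> unitary_group" by (rule unitary_hexp[OF K])
    have "hexp 1 (?V ** M1 ** adj ?V) = W ** hexp h Y"
      unfolding hexp_conj[OF M1(1) V] M1_eq
      by (simp add: matrix_mul_assoc[symmetric] unitary_cancel V unitaryD)
    \<comment> \<open>After undoing the conjugation, the rest of the second arc is appended.\<close>
    then obtain M where M: "hermitian M" "\<phi> M \<le> \<phi> (?V ** M1 ** adj ?V) + \<phi> ((1 - h) *\<^sub>R Y)"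
        "hexp 1 M = W ** hexp h Y ** hexp 1 ((1 - h) *\<^sub>R Y)"
      using log_product[OF hermitian_conj[OF M1(1)] hermitian_scaleR[OF Y], of ?V "1 - h"] by auto
    have "hexp 1 M = hexp 1 X ** hexp 1 Y"
      using hexp_add[OF Y, of h "1 - h"] by (simp add: M(3) hexp_scaleR W_def matrix_mul_assoc[symmetric])
    from min[OF M(1) this] have 1: "\<phi> X + \<phi> Y \<le> \<phi> (X' + h *\<^sub>R P) + h * \<epsilon> + (1 - h) * \<phi> Y"
      using M(2) M1(2) M0_le h by (simp add: unitary_conj V scaleR)
    \<comment> \<open>A convex combination makes the bound linear in \<open>h\<close>; the terms
      free of \<open>h\<close> cancel and \<open>h\<close> can be divided out.\<close>
    have "X' + h *\<^sub>R P = (1 - h) *\<^sub>R X' + h *\<^sub>R (X' + P)"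
      by (simp add: algebra_simps)
    then have "\<phi> (X' + h *\<^sub>R P) \<le> (1 - h) * \<phi> X' + h * \<phi> (X' + P)"
      using triangle[of "(1 - h) *\<^sub>R X'" "h *\<^sub>R (X' + P)"] h by (simp add: scaleR)
    also have "\<dots> \<le> (1 - h) * \<phi> X + h * \<phi> (X' + P)"
      using X'(3) h by (intro add_right_mono mult_left_mono) auto
    finally have "h * (\<phi> X + \<phi> Y) \<le> h * (\<phi> (X' + P) + \<epsilon>)"
      using 1 by (simp add: algebra_simps)
    then show ?thesis using h(1) by simp
  qed
  then have "\<phi> X + \<phi> Y \<le> \<phi> (X' + P)" by (rule field_le_epsilon)
  \<comment> \<open>The upper bound \<open>\<phi> X' + \<phi> P\<close> is itself at most
    \<open>\<phi> X + \<phi> Y\<close>, so every inequality in the chain is an equality.\<close>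
  with triangle[of X' P] X'(3) PY have "\<phi> P = \<phi> Y" "\<phi> X' = \<phi> X" "\<phi> (X' + P) = \<phi> X + \<phi> Y"
    by linarith+
  with eqD X' show ?thesis by (auto simp: W_def)
qed

text \<open>Strict convexity makes a logarithm of exp (i X) parallel to \<open>Y\<close>. The two
  then commute, so their sum is a logarithm of exp (i Z) of no larger norm, hence \<open>Z\<close>
  itself, and the summands are multiples of \<open>Z\<close>.\<close>

lemma geodesic_rigidity:
  assumes strict: "strictly_convex_norm \<phi>" and Z: "hermitian Z" "spectral_norm Z < pi"
    and X: "hermitian X" and Y: "hermitian Y"
    and XY: "hexp 1 X ** hexp 1 Y = hexp 1 Z" and le: "\<phi> X + \<phi> Y \<le> \<phi> Z"
  shows "\<exists>\<tau>\<ge>0. \<phi> X = \<tau> * \<phi> Z \<and> hexp 1 X = hexp \<tau> Z"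
proof -
  have "\<exists>X'. hermitian X' \<and> hexp 1 X' = hexp 1 X \<and> \<phi> X' = \<phi> X \<and> \<phi> (X' + Y) = \<phi> X' + \<phi> Y"
  proof (rule triangle_equality[OF strict X Y])
    fix M assume "hermitian M" "hexp 1 M = hexp 1 X ** hexp 1 Y"
    then have "\<phi> Z \<le> \<phi> M" using minimal_log[OF Z(1), of M] Z(2) XY by simp
    with le show "\<phi> X + \<phi> Y \<le> \<phi> M" by simp
  qed
  then obtain X' where X': "hermitian X'" "hexp 1 X' = hexp 1 X" "\<phi> X' = \<phi> X" "\<phi> (X' + Y) = \<phi> X' + \<phi> Y"
    by blast
  then obtain s where s: "s \<ge> 0" "X' = s *\<^sub>R Y \<or> Y = s *\<^sub>R X'"
    using strict unfolding strictly_convex_norm_def by blast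
  then have comm: "X' ** Y = Y ** X'"
    by (auto simp: scaleR_mult_left scaleR_mult_right)
  have sum: "X' + Y = Z"
  proof (rule minimal_log_unique[OF strict Z(1) _ Z(2)])
    show "hermitian (X' + Y)" by (rule hermitian_add[OF X'(1) Y])
    show "hexp 1 Z = hexp 1 (X' + Y)" by (simp add: hexp_commuting_add X' Y comm XY)
    show "\<phi> (X' + Y) \<le> \<phi> Z" using le X' by simp
  qed
  have "\<exists>\<tau>\<ge>0. X' = \<tau> *\<^sub>R Z"
    using s(2)
  proof
    assume *: "X' = s *\<^sub>R Y"
    then have "Z = (1 + s) *\<^sub>R Y" using sum by (simp add: algebra_simps)
    then have "X' = (s / (1 + s)) *\<^sub>R Z" using s(1) * by simp
    then show ?thesis using s(1) by (intro exI[of _ "s / (1 + s)"]) simp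
  next
    assume "Y = s *\<^sub>R X'"
    then have "Z = (1 + s) *\<^sub>R X'" using sum by (simp add: algebra_simps)
    then have "X' = (1 / (1 + s)) *\<^sub>R Z" using s(1) by simp
    then show ?thesis using s(1) by (intro exI[of _ "1 / (1 + s)"]) simp
  qed
  then obtain \<tau> where \<tau>: "\<tau> \<ge> 0" "X' = \<tau> *\<^sub>R Z" by blast
  then have "\<phi> X = \<tau> * \<phi> Z" "hexp 1 X = hexp \<tau> Z"
    using X'(2,3) by (auto simp: scaleR hexp_scaleR)
  with \<tau>(1) show ?thesis by blast
qed

end

section \<open>Shortest curves\<close>

lemma mono_interval_image:
  fixes \<tau> :: "real \<Rightarrow> real"
  assumes "a \<le> b" "continuous_on {a..b} \<tau>" "mono_on {a..b} \<tau>" "\<tau> a = c" "\<tau> b = d"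
  shows "\<tau> ` {a..b} = {c..d}"
proof
  show "\<tau> ` {a..b} \<subseteq> {c..d}"
  proof clarify
    fix t assume t: "t \<in> {a..b}"
    then show "\<tau> t \<in> {c..d}"
      using mono_onD[OF assms(3), of a t] mono_onD[OF assms(3), of t b] assms(1,4,5) by auto
  qed
  show "{c..d} \<subseteq> \<tau> ` {a..b}"
  proof
    fix y assume "y \<in> {c..d}"
    then obtain x where "a \<le> x" "x \<le> b" "\<tau> x = y"
      using IVT'[of \<tau> a y b] assms by auto
    then show "y \<in> \<tau> ` {a..b}" by force
  qed
qed

lemma geodesic_has_vector_derivative:
  fixes U Z :: "('n::finite) cmatrix"
  assumes "hermitian Z"
  shows "((\<lambda>t. U ** hexp t Z) has_vector_derivative U ** (cscale \<i> Z ** hexp t Z)) (at t within S)"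
  using has_vector_derivative_matrix_mult[OF has_vector_derivative_const hexp_has_vector_derivative[OF assms]]
  by simp

lemma joining_curve_geodesic:
  fixes Z :: "('n::finite) cmatrix"
  assumes U: "U \<in> unitary_group" and Z: "hermitian Z"
  shows "joining_curve U (U ** hexp 1 Z) (\<lambda>t. U ** hexp t Z) 0 1"
proof -
  have "C1_on_interval (\<lambda>t. U ** hexp t Z) 0 1"
    unfolding C1_on_interval_def
    by (intro exI[of _ "\<lambda>t. U ** (cscale \<i> Z ** hexp t Z)"] conjI ballI
        geodesic_has_vector_derivative[OF Z] continuous_intros continuous_on_hexp[OF Z])
  then have "piecewise_smooth_curve (\<lambda>t. U ** hexp t Z) 0 1"
    unfolding piecewise_smooth_curve_def
    by (auto intro!: continuous_intros continuous_on_hexp[OF Z] exI[of _ "1::nat"] exI[of _ real])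
  then show ?thesis
    by (auto simp: joining_curve_def hexp_zero[OF Z] unitary_mult U unitary_hexp[OF Z])
qed

lemma spectral_norm_one_minus_hexp:
  assumes "hermitian Z" "spectral_norm Z \<le> pi"
  shows "spectral_norm (mat 1 - hexp 1 Z) < 2 \<longleftrightarrow> spectral_norm Z < pi"
proof -
  obtain Q \<theta> where Q: "Q \<in> unitary_group" and Z: "Z = udiag Q (\<lambda>j. complex_of_real (\<theta> j))"
    using hermitian_diagonalization[OF assms(1)] by blast
  have \<theta>: "\<bar>\<theta> j\<bar> \<le> pi" for j
    using assms(2) by (simp add: Z spectral_norm_udiag_le[OF Q])
  have "mat 1 - hexp 1 Z = udiag Q (\<lambda>j. 1) + cscale (- 1) (hexp 1 Z)"
    by (simp add: udiag_one Q cscale_minus_one)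
  also have "\<dots> = udiag Q (\<lambda>j. 1 - cis (\<theta> j))"
    by (simp add: Z hexp_udiag[OF Q] udiag_cscale udiag_add)
  finally show ?thesis
    by (simp add: spectral_norm_udiag[OF Q] Z cmod_one_minus_cis_less_2 \<theta>)
qed

context ui_norm
begin

lemma curve_length_geodesic:
  assumes U: "U \<in> unitary_group" and Z: "hermitian Z"
  shows "curve_length \<phi> (\<lambda>t. U ** hexp t Z) 0 1 = \<phi> Z"
proof -
  have "\<phi> (vector_derivative (\<lambda>t. U ** hexp t Z) (at t within {0..1})) = \<phi> Z" if "t \<in> {0..1}" for t
  proof -
    have "vector_derivative (\<lambda>t. U ** hexp t Z) (at t within {0..1}) = U ** (cscale \<i> Z ** hexp t Z)"
      by (rule vector_derivative_within_closed_interval[OF _ that geodesic_has_vector_derivative[OF Z]]) simp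
    then show ?thesis
      by (simp add: unitary_left U unitary_right unitary_hexp Z cscale)
  qed
  then have "integral {0..1} (\<lambda>t. \<phi> (vector_derivative (\<lambda>t. U ** hexp t Z) (at t within {0..1})))
      = integral {0..1} (\<lambda>_::real. \<phi> Z)"
    by (rule integral_cong)
  then show ?thesis by (simp add: curve_length_def)
qed

lemma geodesic_length_minimal:
  assumes U: "U \<in> unitary_group" and Z: "hermitian Z" "spectral_norm Z \<le> pi"
    and \<gamma>: "joining_curve U (U ** hexp 1 Z) \<gamma> a b"
  shows "\<phi> Z \<le> curve_length \<phi> \<gamma> a b"
proof -
  have pw: "piecewise_smooth_curve \<gamma> a b" and im: "\<gamma> ` {a..b} \<subseteq> unitary_group"
    and ends: "\<gamma> a = U" "\<gamma> b = U ** hexp 1 Z"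
    using \<gamma> by (auto simp: joining_curve_def)
  have "a \<le> b" using pw by (simp add: piecewise_smooth_curve_def)
  then obtain X where X: "hermitian X" "\<phi> X \<le> curve_length \<phi> \<gamma> a b" "\<gamma> b = \<gamma> a ** hexp 1 X"
    using log_along_curve(2)[OF pw im order_refl _ order_refl] unfolding curve_length_def by blast
  then have "hexp 1 Z = hexp 1 X" using ends by (metis U unitary_cancel(1))
  from minimal_log[OF Z(1) X(1) Z(2) this] X(2) show ?thesis by simp
qed

text \<open>Each time splits the curve into two arcs with logarithms bounded by their lengths, to
  which rigidity applies. The parameter on the geodesic is arc length divided by \<phi> Z.\<close>

lemma shortest_curve_unique:
  assumes strict: "strictly_convex_norm \<phi>"
    and U: "U \<in> unitary_group" and Z: "hermitian Z" "spectral_norm Z < pi"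
    and \<gamma>: "joining_curve U (U ** hexp 1 Z) \<gamma> a b" and len: "curve_length \<phi> \<gamma> a b \<le> \<phi> Z"
  shows "reparametrization \<gamma> a b (\<lambda>t. U ** hexp t Z)"
proof -
  have pw: "piecewise_smooth_curve \<gamma> a b" and im: "\<gamma> ` {a..b} \<subseteq> unitary_group"
    and ends: "\<gamma> a = U" "\<gamma> b = U ** hexp 1 Z"
    using \<gamma> by (auto simp: joining_curve_def)
  have ab: "a < b" using pw by (simp add: piecewise_smooth_curve_def)
  define g where "g t = \<phi> (vector_derivative \<gamma> (at t within {a..b}))" for t
  have int: "g integrable_on {a..b}"
    using log_along_curve(1)[OF pw im] unfolding g_def .
  define F where "F t = integral {a..t} g" for t
  have F_b: "F b \<le> \<phi> Z" using len by (simp add: F_def g_def[abs_def] curve_length_def)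
  have F_add: "F s + integral {s..t} g = F t" if "a \<le> s" "s \<le> t" "t \<le> b" for s t
    unfolding F_def using that
    by (intro Henstock_Kurzweil_Integration.integral_combine integrable_on_subinterval[OF int]) auto
  have F_mono: "F s \<le> F t" if "a \<le> s" "s \<le> t" "t \<le> b" for s t
  proof -
    have "integral {s..t} g \<ge> 0"
      using that by (intro integral_nonneg integrable_on_subinterval[OF int]) (auto simp: g_def nonneg)
    then show ?thesis using F_add[OF that] by simp
  qed
  have point: "\<exists>\<tau>. F t = \<tau> * \<phi> Z \<and> \<gamma> t = U ** hexp \<tau> Z" if t: "t \<in> {a..b}" for t
  proof -
    obtain X where X: "hermitian X" "\<phi> X \<le> F t" "\<gamma> t = U ** hexp 1 X"
      using log_along_curve(2)[OF pw im order_refl, of t] t ends(1) unfolding F_def g_def[abs_def] by auto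
    obtain Y where Y: "hermitian Y" "\<phi> Y \<le> integral {t..b} g" "\<gamma> b = \<gamma> t ** hexp 1 Y"
      using log_along_curve(2)[OF pw im _ _ order_refl, of t] t unfolding g_def[abs_def] by auto
    have "adj U ** (U ** hexp 1 Z) = adj U ** (U ** (hexp 1 X ** hexp 1 Y))"
      using Y(3) X(3) ends(2) by (simp add: matrix_mul_assoc)
    then have XY: "hexp 1 X ** hexp 1 Y = hexp 1 Z"
      by (simp add: unitary_cancel U)
    have le: "\<phi> X + \<phi> Y \<le> \<phi> Z"
      using X(2) Y(2) F_add[of t b] F_b t by auto
    obtain M where M: "hermitian M" "\<phi> M \<le> \<phi> X + \<phi> Y" "hexp 1 M = hexp 1 Z"
      using log_product[OF X(1) Y(1)] XY by auto
    \<comment> \<open>With both upper bounds by arc length and total length at most \<phi> Z, this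
      leaves no slack, so \<phi> X is exactly the arc length up to \<open>t\<close>.\<close>
    have "\<phi> Z \<le> \<phi> X + \<phi> Y"
      using minimal_log[OF Z(1) M(1)] Z(2) M by simp
    then have "F t = \<phi> X"
      using X(2) Y(2) F_add[of t b] F_b t by auto
    with geodesic_rigidity[OF strict Z X(1) Y(1) XY le] X(3) show ?thesis by metis
  qed
  have "\<exists>\<tau>. continuous_on {a..b} \<tau> \<and> mono_on {a..b} \<tau> \<and> \<tau> a = 0 \<and> \<tau> b = 1 \<and> (\<forall>t\<in>{a..b}. \<gamma> t = U ** hexp (\<tau> t) Z)"
  proof (cases "Z = 0")
    \<comment> \<open>The curve is constant and arc length yields no parameter, so an affine one is
      used.\<close>
    case True
    have "continuous_on {a..b} (\<lambda>t. (t - a) / (b - a))"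
      using ab by (intro continuous_intros) auto
    moreover have "mono_on {a..b} (\<lambda>t. (t - a) / (b - a))"
      using ab by (auto simp: mono_on_def divide_right_mono)
    ultimately show ?thesis
      using point ab True by (intro exI[of _ "\<lambda>t. (t - a) / (b - a)"]) auto
  next
    case False
    then have pos: "\<phi> Z > 0" by (metis eq_0_iff nonneg order_less_le)
    have "continuous_on {a..b} (\<lambda>t. F t / \<phi> Z)"
      unfolding F_def using pos by (intro continuous_intros indefinite_integral_continuous_1 int) auto
    moreover have "mono_on {a..b} (\<lambda>t. F t / \<phi> Z)"
      using pos F_mono by (auto simp: mono_on_def divide_right_mono)
    moreover have "F a = 0" by (simp add: F_def)
    moreover have "F b = \<phi> Z"
      using geodesic_length_minimal[OF U Z(1) _ \<gamma>] Z(2) F_b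
      by (simp add: F_def g_def[abs_def] curve_length_def)
    moreover have "\<gamma> t = U ** hexp (F t / \<phi> Z) Z" if "t \<in> {a..b}" for t
      using point[OF that] pos by auto
    ultimately show ?thesis
      using pos by (intro exI[of _ "\<lambda>t. F t / \<phi> Z"]) auto
  qed
  then obtain \<tau> where \<tau>: "continuous_on {a..b} \<tau>" "mono_on {a..b} \<tau>" "\<tau> a = 0" "\<tau> b = 1"
    "\<And>t. t \<in> {a..b} \<Longrightarrow> \<gamma> t = U ** hexp (\<tau> t) Z"
    by blast
  then have "\<tau> ` {a..b} = {0..1}"
    using ab by (intro mono_interval_image) auto
  with \<tau> show ?thesis unfolding reparametrization_def by blast
qed

end

theorem theorem4p3:
  fixes \<phi> :: "complex^'n^'n \<Rightarrow> real"
    and U V Z :: "complex^'n^'n"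
    and \<delta> :: "real \<Rightarrow> complex^'n^'n"
  assumes "is_norm \<phi>" and "unitarily_invariant \<phi>"
    and "U \<in> unitary_group" and "V \<in> unitary_group"
    and "hermitian Z" and "spectral_norm Z \<le> pi"
    and "V = U ** matrix_exp (cscale \<i> Z)"
  defines "\<delta> \<equiv> \<lambda>t. U ** matrix_exp (cscale (\<i> * complex_of_real t) Z)"
  shows "joining_curve U V \<delta> 0 1 \<and>
    (\<forall>\<gamma> a b. joining_curve U V \<gamma> a b \<longrightarrow> curve_length \<phi> \<delta> 0 1 \<le> curve_length \<phi> \<gamma> a b) \<and>
    geodesic_dist \<phi> U V = \<phi> Z \<and>
    (spectral_norm (U - V) < 2 \<longleftrightarrow> spectral_norm Z < pi) \<and>
    (spectral_norm (U - V) < 2 \<and> strictly_convex_norm \<phi> \<longrightarrow>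
       (\<forall>\<gamma> a b. shortest_curve \<phi> U V \<gamma> a b \<longrightarrow> reparametrization \<gamma> a b \<delta>))"
proof -
  interpret ui_norm \<phi> by unfold_locales (fact assms)+
  note U = assms(3) and Z = assms(5,6)
  have V: "V = U ** hexp 1 Z" by (simp add: assms(7) hexp_def)
  have \<delta>: "\<delta> = (\<lambda>t. U ** hexp t Z)" by (simp add: \<delta>_def hexp_def)
  have join: "joining_curve U V \<delta> 0 1"
    unfolding V \<delta> by (rule joining_curve_geodesic[OF U Z(1)])
  have len: "curve_length \<phi> \<delta> 0 1 = \<phi> Z"
    unfolding \<delta> by (rule curve_length_geodesic[OF U Z(1)])
  have min: "\<phi> Z \<le> curve_length \<phi> \<gamma> a b" if "joining_curve U V \<gamma> a b" for \<gamma> a b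
    using geodesic_length_minimal[OF U Z] that unfolding V .
  have dist: "geodesic_dist \<phi> U V = \<phi> Z"
    unfolding geodesic_dist_def
  proof (rule cInf_eq_minimum)
    show "\<phi> Z \<in> {curve_length \<phi> \<gamma> a b |\<gamma> a b. joining_curve U V \<gamma> a b}"
      using join len by force
  qed (use min in auto)
  have "U - V = U ** (mat 1 - hexp 1 Z)"
    by (simp add: V matrix_diff_ldistrib)
  then have spec: "spectral_norm (U - V) < 2 \<longleftrightarrow> spectral_norm Z < pi"
    by (simp add: spectral_norm_unitary_mult[OF U] spectral_norm_one_minus_hexp[OF Z])
  have "reparametrization \<gamma> a b \<delta>"
    if "spectral_norm (U - V) < 2" "strictly_convex_norm \<phi>" "shortest_curve \<phi> U V \<gamma> a b" for \<gamma> a b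
    unfolding \<delta>
  proof (rule shortest_curve_unique[OF that(2) U Z(1)])
    show "spectral_norm Z < pi" using that(1) spec by simp
    show "joining_curve U (U ** hexp 1 Z) \<gamma> a b"
      using that(3) by (simp add: shortest_curve_def V)
    have "curve_length \<phi> \<gamma> a b \<le> curve_length \<phi> \<delta> 0 1"
      using that(3) join unfolding shortest_curve_def by blast
    then show "curve_length \<phi> \<gamma> a b \<le> \<phi> Z" by (simp add: len)
  qed
  with join len min dist spec show ?thesis by auto
qed

end
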